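(* Let $n\ge 7$ be odd, and set $k=\lfloor n/2\rfloor$. For $Y=(y_{i,j})\in\mathbb R^{[n]\times[k]}$ write $R_{i,j}(Y)=\sum_{j'=1}^{j}y_{i,j'}$ and $K_{i,j}(Y)=\sum_{i'=1}^{i}y_{i',j}$. The facets of $P^{\mathrm{core}}_{\mathrm{VSASM}}$ are exactly the following faces of $P^{\mathrm{core}}_{\mathrm{VSASM}}$, one for each listed equation: (a) the faces $\{R_{i,j}(Y)=0\}$ for $(i,j)$ with $i\in[3,n-2]$, $j\in[k-1-\chi_{2\mid i}]$; (b) the faces $\{R_{i,j}(Y)=1\}$ for $(i,j)$ with $i\in[4,n-3]$, $j\in[2,k-1-\chi_{2\nmid i}]$; (c) the faces $\{K_{i,j}(Y)=0\}$ for $(i,j)\in\{(2,1)\}\cup\{(i,j): i\in[2,n-4],\ j\in[2,k-\chi_{2\mid i}]\}$; (d) the faces $\{K_{i,j}(Y)=1\}$ for $(i,j)\in\{(n-2,1)\}\cup\{(i,j): i\in[4,n-2],\ j\in[2,k-\chi_{2\nmid i}]\}$. In particular, the number of facets of $P^{\mathrm{core}}_{\mathrm{VSASM}}$ is $2n^2-19n+49$.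
   Context: $[a,b]=\{a,a+1,\dots,b\}$ for integers $a\le b$, $[a,b]=\emptyset$ if $a>b$, and $[n]=[1,n]$. $\chi_{\mathcal P}$ equals $1$ if the predicate $\mathcal P$ holds and $0$ otherwise. An $n\times n$ alternating sign matrix (ASM) is an $n\times n$ matrix with entries in $\{0,1,-1\}$ such that in each row and each column the non-zero entries alternate in sign and the first and last non-zero entries are $1$ (so every row and column sums to $1$). A VSASM is an $n\times n$ ASM $X$ with $x_{i,j}=x_{i,n+1-j}$ for all $i,j\in[n]$. For odd $n$ and $k=\lfloor n/2\rfloor$, the core of a VSASM $X$ is its left $n\times k$ block $(x_{i,j})_{(i,j)\in[n]\times[k]}\in\mathbb R^{[n]\times[k]}$, and $P^{\mathrm{core}}_{\mathrm{VSASM}}\subseteq\mathbb R^{[n]\times[k]}$ is the convex hull of the cores of all $n\times n$ VSASMs. A facet of a polytope $P$ is a face of dimension $\dim P-1$; by "the face $\{L(Y)=c\}$" we mean $\{Y\in P^{\mathrm{core}}_{\mathrm{VSASM}}: L(Y)=c\}$. *)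

theory Defs
  imports "HOL-Analysis.Analysis"
begin

text \<open>An \<open>n \<times> n\<close> matrix is a function \<open>nat \<Rightarrow> nat \<Rightarrow> real\<close> read on the indices \<open>1, \<dots>, n\<close> only.\<close>

definition alternating_line :: "nat \<Rightarrow> (nat \<Rightarrow> real) \<Rightarrow> bool" where
  "alternating_line n f \<longleftrightarrow>
     (let xs = filter (\<lambda>x. x \<noteq> 0) (map f [1..<Suc n])
      in xs \<noteq> [] \<and> hd xs = 1 \<and> last xs = 1 \<and> successively (\<lambda>x y. sgn y = - sgn x) xs)"

definition ASM :: "nat \<Rightarrow> (nat \<Rightarrow> nat \<Rightarrow> real) \<Rightarrow> bool" where
  "ASM n X \<longleftrightarrow>
     (\<forall>i\<in>{1..n}. \<forall>j\<in>{1..n}. X i j \<in> {0, 1, -1}) \<and>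
     (\<forall>i\<in>{1..n}. alternating_line n (\<lambda>j. X i j)) \<and>
     (\<forall>j\<in>{1..n}. alternating_line n (\<lambda>i. X i j))"

definition VSASM :: "nat \<Rightarrow> (nat \<Rightarrow> nat \<Rightarrow> real) \<Rightarrow> bool" where
  "VSASM n X \<longleftrightarrow> ASM n X \<and> (\<forall>i\<in>{1..n}. \<forall>j\<in>{1..n}. X i j = X i (n + 1 - j))"

text \<open>The space of real matrices indexed by \<open>[n] \<times> [k]\<close> is rendered as \<open>real ^ 'k ^ 'n\<close>, together with
  enumerations \<open>row_ix\<close> and \<open>col_ix\<close> that map \<open>{1..n}\<close> and \<open>{1..k}\<close> bijectively onto the index types \<open>'n\<close>
  and \<open>'k\<close>; the entry \<open>y\<^sub>i\<^sub>,\<^sub>j\<close> is \<open>Y $ row_ix i $ col_ix j\<close>.\<close>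

definition VSASM_cores :: "nat \<Rightarrow> (nat \<Rightarrow> 'n::finite) \<Rightarrow> (nat \<Rightarrow> 'k::finite) \<Rightarrow> (real ^ 'k ^ 'n) set" where
  "VSASM_cores n row_ix col_ix =
     {Y. \<exists>X. VSASM n X \<and> (\<forall>i\<in>{1..n}. \<forall>j\<in>{1..n div 2}. Y $ row_ix i $ col_ix j = X i j)}"

definition P_core :: "nat \<Rightarrow> (nat \<Rightarrow> 'n::finite) \<Rightarrow> (nat \<Rightarrow> 'k::finite) \<Rightarrow> (real ^ 'k ^ 'n) set" where
  "P_core n row_ix col_ix = convex hull (VSASM_cores n row_ix col_ix)"

definition row_sum ::
    "(nat \<Rightarrow> 'n::finite) \<Rightarrow> (nat \<Rightarrow> 'k::finite) \<Rightarrow> nat \<Rightarrow> nat \<Rightarrow> real ^ 'k ^ 'n \<Rightarrow> real" where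
  "row_sum row_ix col_ix i j Y = (\<Sum>j'=1..j. Y $ row_ix i $ col_ix j')"

definition col_sum ::
    "(nat \<Rightarrow> 'n::finite) \<Rightarrow> (nat \<Rightarrow> 'k::finite) \<Rightarrow> nat \<Rightarrow> nat \<Rightarrow> real ^ 'k ^ 'n \<Rightarrow> real" where
  "col_sum row_ix col_ix i j Y = (\<Sum>i'=1..i. Y $ row_ix i' $ col_ix j)"

text \<open>Formal equations: \<open>RowEq i j c\<close> stands for \<open>R\<^sub>i\<^sub>,\<^sub>j(Y) = c\<close> and \<open>ColEq i j c\<close> for \<open>K\<^sub>i\<^sub>,\<^sub>j(Y) = c\<close>.
  Keeping them syntactic makes it meaningful to say that different equations cut out different faces.\<close>

datatype equation = RowEq nat nat real | ColEq nat nat real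

fun satisfies ::
    "(nat \<Rightarrow> 'n::finite) \<Rightarrow> (nat \<Rightarrow> 'k::finite) \<Rightarrow> equation \<Rightarrow> real ^ 'k ^ 'n \<Rightarrow> bool" where
  "satisfies row_ix col_ix (RowEq i j c) Y \<longleftrightarrow> row_sum row_ix col_ix i j Y = c"
| "satisfies row_ix col_ix (ColEq i j c) Y \<longleftrightarrow> col_sum row_ix col_ix i j Y = c"

definition core_face ::
    "nat \<Rightarrow> (nat \<Rightarrow> 'n::finite) \<Rightarrow> (nat \<Rightarrow> 'k::finite) \<Rightarrow> equation \<Rightarrow> (real ^ 'k ^ 'n) set" where
  "core_face n row_ix col_ix e = {Y \<in> P_core n row_ix col_ix. satisfies row_ix col_ix e Y}"

end

theory Submission
  imports Defs
begin

text \<open>In terms of the corner sums \<open>H i j\<close> (sums of the entries over \<open>[i] \<times> [j]\<close>) the row and column partial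
  sums are differences of neighbouring entries. The core of a VSASM has \<open>H i k = \<lfloor>i / 2\<rfloor>\<close>, \<open>H 0 j = H 1 j = 0\<close>
  and \<open>H (n - 1) j = H n j = j\<close>, and all neighbouring differences are \<open>0\<close> or \<open>1\<close>. Relaxing this to
  differences in \<open>[0, 1]\<close> gives exactly the convex hull: if \<open>g\<close> is nondecreasing with \<open>g (x + 1) = g x + 1\<close> and
  \<open>g 0 = 0\<close>, then \<open>g \<circ> H\<close> satisfies the same constraints as \<open>H\<close>, and every nonintegral \<open>H\<close> is the midpoint of two
  such perturbations, hence not extreme.

  It remains to find an irredundant subsystem of these difference constraints. The listed inequalities imply the
  others together with the boundary values. Each listed inequality can be violated alone: the constraints are stable
  under pointwise minima and maxima, so one clips a matrix that violates a single constraint of the infinite grid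
  between the lowest and the highest feasible corner sums; constraints at the boundary are violated alone by
  changing one entry of the lowest or highest matrix.\<close>

section \<open>Irredundant systems of inequalities\<close>

text \<open>The strict point \<open>z\<close> makes \<open>A\<close> the affine hull of
  \<open>P\<close>, and the points from \<open>irr\<close> show that dropping any inequality
  enlarges the set, so \<open>facet_of_polyhedron_explicit\<close> applies. Injectivity is proved
  separately: distinct indices give distinct facets, which the count relies on.\<close>

lemma bij_betw_facets_of_irredundant_system:
  fixes f :: "'i \<Rightarrow> 'a::euclidean_space \<Rightarrow> real"
  assumes I: "finite I" and A: "affine A" and lin: "\<And>e. e \<in> I \<Longrightarrow> linear (f e)"
    and z: "z \<in> A" "\<And>e. e \<in> I \<Longrightarrow> f e z < c e"
    and irr: "\<And>e. e \<in> I \<Longrightarrow> \<exists>x\<in>A. c e < f e x \<and> (\<forall>e'\<in>I - {e}. f e' x \<le> c e')"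
    and P: "P = {x \<in> A. \<forall>e\<in>I. f e x \<le> c e}"
  shows "bij_betw (\<lambda>e. {x \<in> P. f e x = c e}) I {F. F facet_of P}"
proof -
  \<comment> \<open>The vector representing the functional \<open>f e\<close> as an inner
    product.\<close>
  define a where "a e = adjoint (f e) 1" for e
  have a: "f e x = a e \<bullet> x" if "e \<in> I" for e x
    using adjoint_works[OF lin[OF that], of x 1] by (simp add: a_def inner_commute)
  define h where "h e = {x. f e x \<le> c e}" for e
  \<comment> \<open>An open neighbourhood of \<open>z\<close> inside every half-space, so cutting
    \<open>A\<close> with the half-spaces does not shrink the affine hull.\<close>
  define O' where "O' = (\<Inter>e\<in>I. {x. f e x < c e})"
  have "open O'"
    unfolding O'_def using I by (intro open_INT) (auto simp: a open_halfspace_lt)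
  moreover have "O' \<subseteq> \<Inter>(h ` I)"
    by (force simp: O'_def h_def)
  ultimately have "O' \<subseteq> interior (\<Inter>(h ` I))"
    by (rule interior_maximal[rotated])
  moreover have "z \<in> O'"
    using z by (auto simp: O'_def)
  ultimately have zint: "z \<in> interior (\<Inter>(h ` I))" by blast
  have PA: "P = A \<inter> \<Inter>(h ` I)"
    unfolding P h_def by auto
  have hull: "affine hull P = A"
    using affine_hull_affine_Int_nonempty_interior[OF A, of "\<Inter>(h ` I)"] z zint
    by (auto simp: PA hull_same A)
  have sep: "\<exists>x\<in>A. x \<notin> h e \<and> (\<forall>e'\<in>I - {e}. x \<in> h e')" if "e \<in> I" for e
    using irr[OF that] by (auto simp: h_def not_le)
  have inj: "inj_on h I"
  proof (rule inj_onI)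
    fix e e' assume "e \<in> I" "e' \<in> I" "h e = h e'"
    then show "e = e'" using sep[of e] by auto
  qed
  \<comment> \<open>\<open>facet_of_polyhedron_explicit\<close> indexes normals and bounds by the
    half-spaces themselves; \<open>g\<close> translates a half-space back to its index.\<close>
  define g where "g = the_inv_into I h"
  have g: "g (h e) = e" if "e \<in> I" for e
    unfolding g_def using the_inv_into_f_f[OF inj that] .
  have facet: "C facet_of P \<longleftrightarrow> (\<exists>H. H \<in> h ` I \<and> C = P \<inter> {x. a (g H) \<bullet> x = c (g H)})" for C
  proof (rule facet_of_polyhedron_explicit)
    show "finite (h ` I)" using I by simp
    show "P = affine hull P \<inter> \<Inter>(h ` I)" unfolding hull by (fact PA)
    show "a (g H) \<noteq> 0 \<and> H = {x. a (g H) \<bullet> x \<le> c (g H)}" if H: "H \<in> h ` I" for H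
    proof -
      obtain e where e: "e \<in> I" "H = h e" using H by blast
      have "a e \<noteq> 0"
        using irr[OF e(1)] z(2)[OF e(1)] a[OF e(1)] by (auto simp: inner_commute)
      then show ?thesis using e g a by (auto simp: h_def)
    qed
    show "P \<subset> affine hull P \<inter> \<Inter>F'" if F': "F' \<subset> h ` I" for F'
    proof -
      obtain e where e: "e \<in> I" "h e \<notin> F'" using F' by blast
      obtain x where x: "x \<in> A" "x \<notin> h e" "\<And>e'. e' \<in> I - {e} \<Longrightarrow> x \<in> h e'"
        using sep[OF e(1)] by blast
      have "x \<in> \<Inter>F'"
      proof
        fix H assume "H \<in> F'"
        with F' e obtain e' where "e' \<in> I - {e}" "H = h e'" by blast
        with x show "x \<in> H" by blast
      qed
      moreover have "x \<notin> P" using x e by (auto simp: PA)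
      moreover have "P \<subseteq> affine hull P \<inter> \<Inter>F'" unfolding hull using F' by (auto simp: PA)
      ultimately show ?thesis using x(1) by (auto simp: hull)
    qed
  qed
  have "{F. F facet_of P} = (\<lambda>e. {x \<in> P. f e x = c e}) ` I"
    unfolding facet by (auto simp: g a Int_def image_iff)
  moreover have "inj_on (\<lambda>e. {x \<in> P. f e x = c e}) I"
  proof (rule inj_onI, rule ccontr)
    fix e e' assume e: "e \<in> I" "e' \<in> I" "{x \<in> P. f e x = c e} = {x \<in> P. f e' x = c e'}" "e \<noteq> e'"
    obtain x where x: "x \<in> A" "c e < f e x" "\<And>e'. e' \<in> I - {e} \<Longrightarrow> f e' x \<le> c e'"
      using irr[OF e(1)] by blast
    \<comment> \<open>The parameter at which the segment from \<open>z\<close> to \<open>x\<close>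
      meets the hyperplane of \<open>e\<close>. As \<open>z\<close> is strict, the point there
      satisfies every other inequality strictly, so it lies on the face of \<open>e\<close> and on
      no other.\<close>
    define t where "t = (c e - f e z) / (f e x - f e z)"
    have t: "0 < t" "t < 1" using x(2) z(2)[OF e(1)] by (auto simp: t_def field_simps)
    define w where "w = (1 - t) *\<^sub>R z + t *\<^sub>R x"
    have f_w: "f d w = (1 - t) * f d z + t * f d x" if "d \<in> I" for d
      using that by (simp add: a w_def inner_add_right)
    have we: "f e w = c e"
    proof -
      have "t * (f e x - f e z) = c e - f e z"
        using x(2) z(2)[OF e(1)] by (simp add: t_def)
      then show ?thesis using f_w[OF e(1)] by (simp add: algebra_simps)
    qed
    have lt: "f d w < c d" if "d \<in> I - {e}" for d
    proof -
      have "(1 - t) * f d z + t * f d x < (1 - t) * c d + t * c d"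
        using t that z(2)[of d] x(3)[of d] by (intro add_less_le_mono mult_strict_left_mono mult_left_mono) auto
      also have "\<dots> = c d" by (simp add: algebra_simps)
      finally show ?thesis using f_w[of d] that by simp
    qed
    have "w \<in> A"
      unfolding w_def using A z(1) x(1) by (auto simp: affine_def)
    then have "w \<in> P" unfolding P using we lt by force
    with we e(3) have "f e' w = c e'" by blast
    then show False using e lt[of e'] by simp
  qed
  ultimately show ?thesis by (simp add: bij_betw_def)
qed

section \<open>Alternating lines and partial sums\<close>

context
  fixes f :: "nat \<Rightarrow> real"
begin

private definition nonzeros :: "nat \<Rightarrow> real list" where
  "nonzeros n = filter (\<lambda>x. x \<noteq> 0) (map f [1..<Suc n])"

private lemma nonzeros_0: "nonzeros 0 = []"
  by (simp add: nonzeros_def)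

private lemma nonzeros_Suc:
  "nonzeros (Suc n) = nonzeros n @ (if f (Suc n) = 0 then [] else [f (Suc n)])"
  by (simp add: nonzeros_def)

text \<open>Signs alternate beginning with 1, so the running sum is 1 after a 1 and 0 after a -1.
  This relation between the last nonzero entry and the sum carries the induction.\<close>

private lemma prefix_sum_if_alternating:
  assumes "\<And>i. i \<in> {1..n} \<Longrightarrow> f i \<in> {0, 1, -1}"
    and "nonzeros n = [] \<or> hd (nonzeros n) = 1"
    and "successively (\<lambda>x y. sgn y = - sgn x) (nonzeros n)"
  shows "if nonzeros n = [] then sum f {1..n} = 0
    else last (nonzeros n) = 2 * sum f {1..n} - 1 \<and> sum f {1..n} \<in> {0, 1}"
  using assms
proof (induction n)
  case 0
  then show ?case by (simp add: nonzeros_0)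
next
  case (Suc n)
  have "nonzeros n = [] \<or> hd (nonzeros n) = 1"
    "successively (\<lambda>x y. sgn y = - sgn x) (nonzeros n)"
    using Suc.prems(2,3) by (auto simp: nonzeros_Suc hd_append successively_append_iff split: if_splits)
  with Suc.IH Suc.prems(1)
  have IH: "if nonzeros n = [] then sum f {1..n} = 0
    else last (nonzeros n) = 2 * sum f {1..n} - 1 \<and> sum f {1..n} \<in> {0, 1}"
    by simp
  have "f (Suc n) \<in> {0, 1, -1}" using Suc.prems(1) by simp
  then consider "f (Suc n) = 0" | "f (Suc n) = 1" | "f (Suc n) = -1" by auto
  then show ?case
    using Suc.prems(2,3) IH
    by cases (auto simp: nonzeros_Suc successively_append_iff split: if_splits)
qed

private lemma nonzeros_prefix:
  assumes "nonzeros n = [] \<or> hd (nonzeros n) = 1"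
    and "successively (\<lambda>x y. sgn y = - sgn x) (nonzeros n)" and "m \<le> n"
  shows "(nonzeros m = [] \<or> hd (nonzeros m) = 1) \<and>
    successively (\<lambda>x y. sgn y = - sgn x) (nonzeros m)"
  using assms(3,1,2)
proof (induction rule: inc_induct)
  case (step i)
  then show ?case
    by (auto simp: nonzeros_Suc hd_append successively_append_iff split: if_splits)
qed simp

text \<open>A sum confined to 0 and 1 can only rise from 0 and fall from 1.\<close>

private lemma alternating_if_prefix_sum:
  assumes "\<And>i. i \<le> n \<Longrightarrow> sum f {1..i} \<in> {0, 1}"
  shows "(if nonzeros n = [] then sum f {1..n} = 0
      else hd (nonzeros n) = 1 \<and> last (nonzeros n) = 2 * sum f {1..n} - 1) \<and>
    successively (\<lambda>x y. sgn y = - sgn x) (nonzeros n)"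
  using assms
proof (induction n)
  case 0
  then show ?case by (simp add: nonzeros_0)
next
  case (Suc n)
  have s: "sum f {1..Suc n} = sum f {1..n} + f (Suc n)" by simp
  have "sum f {1..Suc n} \<in> {0, 1}" "sum f {1..n} \<in> {0, 1}"
    using Suc.prems[of "Suc n"] Suc.prems[of n] by (auto simp del: sum.cl_ivl_Suc)
  then consider "f (Suc n) = 0" | "f (Suc n) = 1" "sum f {1..n} = 0" | "f (Suc n) = -1" "sum f {1..n} = 1"
    unfolding s by force
  then show ?case
    using Suc.IH Suc.prems unfolding s
    by cases (auto simp: nonzeros_Suc successively_append_iff hd_append split: if_splits)
qed

text \<open>The last nonzero entry is twice the total minus 1, so it is 1 exactly when the total is
  1.\<close>

lemma alternating_line_iff:
  assumes "\<And>i. i \<in> {1..n} \<Longrightarrow> f i \<in> {0, 1, -1}"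
  shows "alternating_line n f \<longleftrightarrow> (\<forall>i\<le>n. sum f {1..i} \<in> {0, 1}) \<and> sum f {1..n} = 1"
proof
  assume alt: "alternating_line n f"
  then have n: "nonzeros n \<noteq> []" "hd (nonzeros n) = 1" "last (nonzeros n) = 1"
    "successively (\<lambda>x y. sgn y = - sgn x) (nonzeros n)"
    unfolding alternating_line_def nonzeros_def[symmetric] Let_def by auto
  have "sum f {1..i} \<in> {0, 1}" if "i \<le> n" for i
    using prefix_sum_if_alternating[of i] nonzeros_prefix[of n i] assms n that
    by (auto split: if_splits)
  moreover have "sum f {1..n} = 1"
    using prefix_sum_if_alternating[of n] assms n by auto
  ultimately show "(\<forall>i\<le>n. sum f {1..i} \<in> {0, 1}) \<and> sum f {1..n} = 1" by blast
next
  assume "(\<forall>i\<le>n. sum f {1..i} \<in> {0, 1}) \<and> sum f {1..n} = 1"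
  then show "alternating_line n f"
    using alternating_if_prefix_sum[of n]
    unfolding alternating_line_def nonzeros_def[symmetric] Let_def
    by (auto split: if_splits)
qed

end

section \<open>Perturbations that preserve integral difference bounds\<close>

text \<open>A 1-periodic bump that vanishes exactly at the integers; dividing by
  \<open>2 * pi\<close> makes it 1-Lipschitz. Adding or subtracting it gives the two perturbations
  of noninteger corner sums.\<close>

definition wobble :: "real \<Rightarrow> real" where
  "wobble x = (1 - cos (2 * pi * x)) / (2 * pi)"

lemma wobble_add_of_int: "wobble (x + of_int a) = wobble x"
proof -
  have "cos (2 * pi * (x + of_int a)) = cos (2 * pi * x)"
    by (simp add: distrib_left cos_add cos_int_2pin sin_int_2pin)
  then show ?thesis by (simp add: wobble_def)
qed

lemma wobble_eq_0_iff: "wobble x = 0 \<longleftrightarrow> x \<in> \<int>"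
proof -
  have "wobble x = 0 \<longleftrightarrow> cos (2 * pi * x) = 1" by (auto simp: wobble_def)
  also have "\<dots> \<longleftrightarrow> (\<exists>m::int. x = of_int m)" unfolding cos_one_2pi_int by (auto simp: field_simps)
  finally show ?thesis by (auto simp: Ints_def)
qed

lemma wobble_lipschitz: "\<bar>wobble x - wobble y\<bar> \<le> \<bar>x - y\<bar>"
proof -
  have "\<bar>cos a - cos b\<bar> \<le> \<bar>a - b\<bar>" for a b :: real
  proof -
    have "\<bar>cos a - cos b\<bar> = 2 * (\<bar>sin ((a + b) / 2)\<bar> * \<bar>sin ((b - a) / 2)\<bar>)"
      by (simp add: cos_diff_cos abs_mult)
    also have "\<dots> \<le> 2 * (1 * \<bar>(b - a) / 2\<bar>)"
      using abs_sin_x_le_abs_x[of "(b - a) / 2"] by (intro mult_left_mono mult_mono) auto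
    finally show ?thesis by simp
  qed
  from this[of "2 * pi * y" "2 * pi * x"]
  have "\<bar>cos (2 * pi * y) - cos (2 * pi * x)\<bar> \<le> 2 * pi * \<bar>x - y\<bar>"
    by (simp add: abs_mult abs_minus_commute flip: right_diff_distrib)
  moreover have "wobble x - wobble y = (cos (2 * pi * y) - cos (2 * pi * x)) / (2 * pi)"
    by (simp add: wobble_def diff_divide_distrib)
  ultimately have "\<bar>wobble x - wobble y\<bar> \<le> 2 * pi * \<bar>x - y\<bar> / (2 * pi)"
    using divide_right_mono[of "\<bar>cos (2 * pi * y) - cos (2 * pi * x)\<bar>" "2 * pi * \<bar>x - y\<bar>" "2 * pi"]
    by (simp only: abs_divide) simp
  then show ?thesis by simp
qed

text \<open>The Lipschitz bound makes \<open>x + s * wobble x\<close> nondecreasing in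
  \<open>x\<close>, and periodicity makes this map commute with integer shifts.\<close>

lemma wobble_preserves_difference_bound:
  assumes "x \<le> y + of_int a" and "\<bar>s\<bar> = 1"
  shows "x + s * wobble x \<le> (y + s * wobble y) + of_int a"
proof -
  have "\<bar>wobble x - wobble y\<bar> \<le> y + of_int a - x"
    using wobble_lipschitz[of x "y + of_int a"] assms(1) by (simp add: wobble_add_of_int)
  moreover have "s = 1 \<or> s = -1" using assms(2) by auto
  ultimately show ?thesis by auto
qed

section \<open>Difference constraints for corner sums\<close>

locale vsasm_core =
  fixes n k :: nat
    and row_ix :: "nat \<Rightarrow> 'n::finite"
    and col_ix :: "nat \<Rightarrow> 'k::finite"
  assumes n: "n = 2 * k + 1" and k: "3 \<le> k"
    and row_ix: "bij_betw row_ix {1..n} (UNIV :: 'n set)"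
    and col_ix: "bij_betw col_ix {1..k} (UNIV :: 'k set)"
begin

definition boundary_values :: "(nat \<Rightarrow> nat \<Rightarrow> real) \<Rightarrow> bool" where
  "boundary_values H \<longleftrightarrow>
     (\<forall>i\<le>n. H i 0 = 0 \<and> H i k = real (i div 2)) \<and>
     (\<forall>j\<le>k. H 0 j = 0 \<and> H 1 j = 0 \<and> H (n - 1) j = real j \<and> H n j = real j)"

definition unit_steps :: "(nat \<Rightarrow> nat \<Rightarrow> real) \<Rightarrow> bool" where
  "unit_steps H \<longleftrightarrow> (\<forall>i\<in>{1..n}. \<forall>j\<in>{1..k}.
     H i j - H (i - 1) j \<in> {0..1} \<and> H i j - H i (j - 1) \<in> {0..1})"

definition facet_equations :: "equation set" where
  "facet_equations =
     {RowEq i j 0 | i j. i \<in> {3..n-2} \<and> j \<in> {1..k - 1 - of_bool (even i)}} \<union>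
     {RowEq i j 1 | i j. i \<in> {4..n-3} \<and> j \<in> {2..k - 1 - of_bool (odd i)}} \<union>
     {ColEq i j 0 | i j. (i, j) = (2, 1) \<or> i \<in> {2..n-4} \<and> j \<in> {2..k - of_bool (even i)}} \<union>
     {ColEq i j 1 | i j. (i, j) = (n-2, 1) \<or> i \<in> {4..n-2} \<and> j \<in> {2..k - of_bool (odd i)}}"

text \<open>The factor \<open>2 * c - 1\<close> is \<open>-1\<close> for \<open>c = 0\<close> and \<open>1\<close> for \<open>c = 1\<close>: the inequality
  \<open>lhs H e \<le> rhs e\<close> bounds the sum from below by \<open>0\<close>, respectively from above by \<open>1\<close>.\<close>

fun lhs :: "(nat \<Rightarrow> nat \<Rightarrow> real) \<Rightarrow> equation \<Rightarrow> real" where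
  "lhs H (RowEq i j c) = (2 * c - 1) * (H i j - H (i - 1) j)"
| "lhs H (ColEq i j c) = (2 * c - 1) * (H i j - H i (j - 1))"

fun rhs :: "equation \<Rightarrow> real" where
  "rhs (RowEq i j c) = (2 * c - 1) * c"
| "rhs (ColEq i j c) = (2 * c - 1) * c"

lemma facet_equations_cases:
  assumes "e \<in> facet_equations"
  obtains i j c where "e = RowEq i j c" "i \<in> {3..n-2}" "j \<in> {1..k-1}" "c \<in> {0, 1}"
  | i j c where "e = ColEq i j c" "i \<in> {2..n-2}" "j \<in> {1..k}" "c \<in> {0, 1}"
  using assms n k unfolding facet_equations_def by force

text \<open>Column \<open>k\<close> is fixed by the boundary values, so the listed bounds there
  confine column \<open>k - 1\<close>: \<open>ub\<close> in odd rows, \<open>lb\<close> in even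
  rows. This recovers the inequalities left out by the parity terms. Chains of steps settle column 1
  and the rows near the top and bottom.\<close>

lemma unit_steps_if_facet_inequalities:
  assumes bd: "boundary_values H" and ineq: "\<And>e. e \<in> facet_equations \<Longrightarrow> lhs H e \<le> rhs e"
  shows "unit_steps H"
proof -
  have R0: "H (i - 1) j \<le> H i j" if "i \<in> {3..n-2}" "j \<in> {1..k - 1 - of_bool (even i)}" for i j
    using ineq[of "RowEq i j 0"] that by (simp add: facet_equations_def)
  have R1: "H i j \<le> H (i - 1) j + 1" if "i \<in> {4..n-3}" "j \<in> {2..k - 1 - of_bool (odd i)}" for i j
    using ineq[of "RowEq i j 1"] that by (simp add: facet_equations_def)
  have K0: "H i (j - 1) \<le> H i j"
    if "(i, j) = (2, 1) \<or> i \<in> {2..n-4} \<and> j \<in> {2..k - of_bool (even i)}" for i j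
    using ineq[of "ColEq i j 0"] that by (auto simp: facet_equations_def)
  have K1: "H i j \<le> H i (j - 1) + 1"
    if "(i, j) = (n-2, 1) \<or> i \<in> {4..n-2} \<and> j \<in> {2..k - of_bool (odd i)}" for i j
    using ineq[of "ColEq i j 1"] that by (auto simp: facet_equations_def)
  have left: "H i 0 = 0" "H i k = real (i div 2)" if "i \<le> n" for i
    using bd that by (auto simp: boundary_values_def)
  have top: "H 0 j = 0" "H (Suc 0) j = 0" "H (2 * k) j = real j" "H (Suc (2 * k)) j = real j" if "j \<le> k" for j
    using bd that unfolding boundary_values_def by (auto simp: n)
  have ub: "H (2 * m + 1) (k - 1) \<le> real m" if "1 \<le> m" "m \<le> k - 2" for m
  proof -
    have "H (2 * m + 1) (k - 1) \<le> H (2 * m + 1) k" by (rule K0) (use that n k in auto)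
    also have "\<dots> = real m" by (subst left) (use that n k in auto)
    finally show ?thesis .
  qed
  have lb: "real m - 1 \<le> H (2 * m) (k - 1)" if "2 \<le> m" "m \<le> k - 1" for m
  proof -
    have "H (2 * m) k \<le> H (2 * m) (k - 1) + 1" by (rule K1) (use that n k in auto)
    moreover have "H (2 * m) k = real m" by (subst left) (use that n k in auto)
    ultimately show ?thesis by simp
  qed
  \<comment> \<open>The only unlisted interior case is \<open>j = k - 1\<close> in even rows
    \<open>2 * m\<close>; there \<open>ub\<close> and \<open>lb\<close> place the value
    \<open>m - 1\<close> between the two neighbours.\<close>
  have R0': "H (i - 1) j \<le> H i j" if ij: "i \<in> {3..n-2}" "j \<le> k" for i j
  proof -
    consider "j = 0" | "j = k" | "j \<in> {1..k - 1 - of_bool (even i)}" | "even i" "j = k - 1"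
      using ij k by (cases "even i") force+
    then show ?thesis
    proof cases
      case 4
      then obtain m where m: "i = 2 * m" by blast
      have "i - 1 = 2 * (m - 1) + 1" using m that by auto
      then have "H (i - 1) (k - 1) \<le> real (m - 1)"
        by (simp only:) (rule ub, use m that n k in auto)
      also have "\<dots> = real m - 1" using m that by auto
      also have "\<dots> \<le> H i (k - 1)" unfolding m by (rule lb) (use m that n k in auto)
      finally show ?thesis using 4 by simp
    qed (use R0 that left[of i] left[of "i - 1"] in \<open>auto intro!: div_le_mono\<close>)
  qed
  \<comment> \<open>Column 1 is nondecreasing, so the lower bound in row 2 and the upper bound in
    row \<open>n - 2\<close>, the two single equations of the list, control all of it.\<close>
  have mono1: "H a 1 \<le> H b 1" if "a \<le> b" "2 \<le> a" "b \<le> n - 2" for a b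
    using that
  proof (induction b rule: dec_induct)
    case (step b)
    then show ?case using R0'[of "Suc b" 1] k by auto
  qed simp
  have col1: "0 \<le> H i 1" "H i 1 \<le> 1" if "i \<in> {2..n-2}" for i
  proof -
    have "H 2 0 \<le> H 2 1" using K0[of 2 1] by simp
    also have "\<dots> \<le> H i 1" by (rule mono1) (use that in auto)
    finally show "0 \<le> H i 1" using left[of 2] n k by simp
    have "H i 1 \<le> H (n - 2) 1" by (rule mono1) (use that in auto)
    also have "\<dots> \<le> H (n - 2) 0 + 1" using K1[of "n - 2" 1] by simp
    finally show "H i 1 \<le> 1" using left[of "n - 2"] by simp
  qed
  have K0': "H i (j - 1) \<le> H i j" if ij: "i \<in> {2..n-4}" "j \<in> {1..k}" for i j
  proof -
    consider "j = 1" | "j \<in> {2..k - of_bool (even i)}" | "even i" "j = k"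
      using ij k by (cases "even i") force+
    then show ?thesis
    proof cases
      case 1
      then show ?thesis using col1[of i] left[of i] that by auto
    next
      case 2
      then show ?thesis using K0 that by blast
    next
      case 3
      then obtain m where m: "i = 2 * m" by blast
      have "H (2 * m + 1 - 1) (k - 1) \<le> H (2 * m + 1) (k - 1)" by (rule R0') (use that m n k in auto)
      also have "\<dots> \<le> real m" by (rule ub) (use that m n k in auto)
      moreover have "H i k = real m" by (subst left) (use that m in auto)
      ultimately show ?thesis using 3 m by simp
    qed
  qed
  have K1': "H i j \<le> H i (j - 1) + 1" if ij: "i \<in> {4..n-2}" "j \<in> {1..k}" for i j
  proof -
    consider "j = 1" | "j \<in> {2..k - of_bool (odd i)}" | "odd i" "j = k"
      using ij k by (cases "even i") force+
    then show ?thesis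
    proof cases
      case 1
      then show ?thesis using col1[of i] left[of i] that by auto
    next
      case 2
      then show ?thesis using K1 that by blast
    next
      case 3
      then obtain m where m: "i = 2 * m + 1" by (blast elim: oddE)
      have "real m - 1 \<le> H (2 * m + 1 - 1) (k - 1)"
        unfolding add_diff_cancel_right' by (rule lb) (use that m n k in auto)
      also have "\<dots> \<le> H (2 * m + 1) (k - 1)" by (rule R0') (use that m n k in auto)
      moreover have "H i k = real m" by (subst left) (use that m in auto)
      ultimately show ?thesis using 3 m by simp
    qed
  qed
  \<comment> \<open>In these rows column \<open>k\<close> holds 1, so monotonicity alone confines
    all entries and bounds the steps from above.\<close>
  have upper: "0 \<le> H i j" "H i j \<le> 1" if "i \<in> {2, 3}" "j \<le> k" for i j
  proof -
    have i: "i \<in> {2..n-4}" "i div 2 = 1" "i \<le> n" using that n k by auto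
    have mono: "H i a \<le> H i b" if "a \<le> b" "b \<le> k" for a b
      using that
    proof (induction b rule: dec_induct)
      case (step b)
      then show ?case using K0'[OF i(1), of "Suc b"] by auto
    qed simp
    show "0 \<le> H i j" "H i j \<le> 1"
      using mono[of 0 j] mono[of j k] that left[OF i(3)] i(2) by auto
  qed
  \<comment> \<open>Dually, column \<open>k\<close> holds \<open>k - 1\<close> here, so steps of at
    most 1 allow a deficit of at most 1 against \<open>real j\<close>.\<close>
  have lower: "H i j \<le> real j" "real j - 1 \<le> H i j" if "i \<in> {n-3, n-2}" "j \<le> k" for i j
  proof -
    have i: "i \<in> {4..n-2}" "i \<le> n" using that n k by auto
    have lip: "H i b \<le> H i a + real (b - a)" if "a \<le> b" "b \<le> k" for a b
      using that
    proof (induction b rule: dec_induct)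
      case (step b)
      then show ?case using K1'[OF i(1), of "Suc b"] by (auto simp: Suc_diff_le)
    qed simp
    have "i div 2 = k - 1" using that n k by auto
    then show "H i j \<le> real j" "real j - 1 \<le> H i j"
      using lip[of 0 j] lip[of j k] that left[OF i(2)] k by (auto simp: of_nat_diff)
  qed
  have K: "H i j - H i (j - 1) \<in> {0..1}" if "i \<in> {1..n}" "j \<in> {1..k}" for i j
  proof -
    have j: "j \<le> k" "j - 1 \<le> k" "real (j - 1) = real j - 1" using that by auto
    have "i = 1 \<or> i \<in> {2, 3} \<or> i \<in> {4..n-4} \<or> i \<in> {n-3, n-2} \<or> i = 2 * k \<or> i = Suc (2 * k)"
      using that n k by auto
    then consider "i = 1" | "i \<in> {2, 3}" | "i \<in> {4..n-4}" | "i \<in> {n-3, n-2}" | "i = 2 * k" | "i = Suc (2 * k)"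
      by blast
    then show ?thesis
    proof cases
      case 2
      then show ?thesis
        using upper[OF 2 j(1)] upper[OF 2 j(2)] K0'[of i j] that n k by auto
    next
      case 3
      then have "i \<in> {2..n-4}" "i \<in> {4..n-2}" by auto
      then show ?thesis using K0' K1' that by force
    next
      case 4
      then have i: "i \<in> {4..n-2}" using n k by auto
      then show ?thesis
        using lower[OF 4 j(1)] lower[OF 4 j(2)] K1'[OF i that(2)] j(3) by auto
    qed (use top[OF j(1)] top[OF j(2)] j in auto)
  qed
  have R: "H i j - H (i - 1) j \<in> {0..1}" if ij: "i \<in> {1..n}" "j \<in> {1..k}" for i j
  proof -
    have j: "j \<le> k" using that by simp
    have "i = 1 \<or> i = 2 \<or> i = 3 \<or> i \<in> {4..n-3} \<or> i = n - 2 \<or> i = 2 * k \<or> i = Suc (2 * k)"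
      using that n k by auto
    then consider "i = 1" | "i = 2" | "i = 3" | "i \<in> {4..n-3}" | "i = n-2" | "i = 2 * k" | "i = Suc (2 * k)"
      by blast
    then show ?thesis
    proof cases
      case 1
      then show ?thesis using top[OF j] by auto
    next
      case 2
      then show ?thesis using top[OF j] upper[of 2 j] j by (auto simp: numeral_2_eq_2)
    next
      case 3
      then show ?thesis using R0'[of 3 j] upper[of 2 j] upper[of 3 j] j n k by auto
    next
      case 4
      consider "j = 1" | "j = k" | "j \<in> {2..k - 1 - of_bool (odd i)}" | "odd i" "j = k - 1"
        using ij k by (cases "even i") force+
      then have "H i j \<le> H (i - 1) j + 1"
      proof cases
        case 1
        moreover have "i \<in> {2..n-2}" "i - 1 \<in> {2..n-2}" using 4 n by auto
        ultimately show ?thesis using col1 by force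
      next
        case 2
        then show ?thesis using left[of i] left[of "i - 1"] that by auto
      next
        case 3
        then show ?thesis using R1 4 by blast
      next
        case right: 4
        then obtain m where m: "i = 2 * m + 1" by (blast elim: oddE)
        have "H i j \<le> real m" unfolding m right by (rule ub) (use m 4 n k in auto)
        moreover have "real m - 1 \<le> H (2 * m) j" unfolding right by (rule lb) (use m 4 n k in auto)
        ultimately show ?thesis using m by simp
      qed
      then show ?thesis using R0'[of i j] 4 j by auto
    next
      case 5
      then have "i - 1 = n - 3" by simp
      then show ?thesis using 5 R0'[of i j] lower[of "n - 2" j] lower[of "n - 3" j] j n k by auto
    next
      case 6
      then have "i - 1 = n - 2" using n by simp
      then show ?thesis using 6 lower[of "n - 2" j] top[OF j] j by auto
    next
      case 7
      then show ?thesis using top[OF j] by auto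
    qed
  qed
  show ?thesis using K R by (auto simp: unit_steps_def)
qed

section \<open>Irredundancy\<close>

text \<open>Truncated subtraction supplies the maximum with 0. Steps of at most 1 towards column
  \<open>k\<close>, where the value is \<open>i div 2\<close>, keep every feasible matrix above this
  one.\<close>

definition lowest :: "nat \<Rightarrow> nat \<Rightarrow> real" where
  "lowest i j = real (i div 2 + j - k)"

definition highest :: "nat \<Rightarrow> nat \<Rightarrow> real" where
  "highest i j = real (min j (i div 2))"

definition clip :: "(nat \<Rightarrow> nat \<Rightarrow> real) \<Rightarrow> nat \<Rightarrow> nat \<Rightarrow> real" where
  "clip G i j = max (lowest i j) (min (highest i j) (G i j))"

text \<open>The constraints of the unbounded grid: a matrix can be built without regard to the
  rectangle, and clipping then supplies the boundary values.\<close>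

definition unit_equations :: "equation set" where
  "unit_equations = {RowEq i j c | i j c. 1 \<le> i \<and> c \<in> {0, 1}} \<union> {ColEq i j c | i j c. 1 \<le> j \<and> c \<in> {0, 1}}"

lemma facet_equations_subset: "facet_equations \<subseteq> unit_equations"
  by (auto simp: unit_equations_def elim!: facet_equations_cases)

lemma lowest_le_highest:
  assumes "i \<le> n" "j \<le> k"
  shows "lowest i j \<le> highest i j"
  using assms n by (auto simp: lowest_def highest_def)

lemma boundary_values_lowest: "boundary_values lowest"
  unfolding boundary_values_def lowest_def by (auto simp: n)

lemma boundary_values_highest: "boundary_values highest"
  unfolding boundary_values_def highest_def by (auto simp: n)

lemma lowest_ineq:
  assumes "e \<in> unit_equations"
  shows "lhs lowest e \<le> rhs e"
proof -
  have *: "Suc i div 2 \<le> Suc (i div 2)" "i div 2 \<le> Suc i div 2" for i :: nat by linarith+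
  consider i j c where "e = RowEq (Suc i) j c" "c = 0 \<or> c = 1"
    | i j c where "e = ColEq i (Suc j) c" "c = 0 \<or> c = 1"
    using assms by (auto simp: unit_equations_def Suc_le_eq gr0_conv_Suc)
  then show ?thesis
  proof cases
    case (1 i j c)
    then show ?thesis using *[of i] by (auto simp: lowest_def of_nat_diff)
  next
    case (2 i j c)
    then show ?thesis by (auto simp: lowest_def)
  qed
qed

lemma highest_ineq:
  assumes "e \<in> unit_equations"
  shows "lhs highest e \<le> rhs e"
proof -
  have *: "Suc i div 2 \<le> Suc (i div 2)" "i div 2 \<le> Suc i div 2" for i :: nat by linarith+
  consider i j c where "e = RowEq (Suc i) j c" "c = 0 \<or> c = 1"
    | i j c where "e = ColEq i (Suc j) c" "c = 0 \<or> c = 1"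
    using assms by (auto simp: unit_equations_def Suc_le_eq gr0_conv_Suc)
  then show ?thesis
  proof cases
    case (1 i j c)
    then show ?thesis using *[of i] by (auto simp: highest_def min_def)
  next
    case (2 i j c)
    then show ?thesis by (auto simp: highest_def min_def)
  qed
qed

text \<open>Each inequality bounds a difference of two entries, so all of them are stable under
  pointwise minima and maxima.\<close>

lemma difference_bound:
  assumes "e \<in> unit_equations"
  shows "\<exists>i j i' j' w. \<forall>H. lhs H e \<le> rhs e \<longleftrightarrow> H i j \<le> H i' j' + w"
proof -
  consider i j where "e = RowEq i j 0" | i j where "e = RowEq i j 1"
    | i j where "e = ColEq i j 0" | i j where "e = ColEq i j 1"
    using assms by (auto simp: unit_equations_def)
  then show ?thesis
  proof cases
    case (1 i j)
    then have "\<forall>H. lhs H e \<le> rhs e \<longleftrightarrow> H (i - 1) j \<le> H i j + 0" by simp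
    then show ?thesis by blast
  next
    case (2 i j)
    then have "\<forall>H. lhs H e \<le> rhs e \<longleftrightarrow> H i j \<le> H (i - 1) j + 1" by auto
    then show ?thesis by blast
  next
    case (3 i j)
    then have "\<forall>H. lhs H e \<le> rhs e \<longleftrightarrow> H i (j - 1) \<le> H i j + 0" by simp
    then show ?thesis by blast
  next
    case (4 i j)
    then have "\<forall>H. lhs H e \<le> rhs e \<longleftrightarrow> H i j \<le> H i (j - 1) + 1" by auto
    then show ?thesis by blast
  qed
qed

lemma clip_ineq:
  assumes e: "e \<in> unit_equations" and G: "lhs G e \<le> rhs e"
  shows "lhs (clip G) e \<le> rhs e"
proof -
  obtain i j i' j' w where w: "\<And>H. lhs H e \<le> rhs e \<longleftrightarrow> H i j \<le> H i' j' + w"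
    using difference_bound[OF e] by blast
  show ?thesis
    using lowest_ineq[OF e] highest_ineq[OF e] G
    unfolding w clip_def by (auto simp: max_def min_def)
qed

text \<open>\<open>lowest\<close> and \<open>highest\<close> coincide on the boundary, so clipping
  forces the right values there whatever \<open>G\<close> is.\<close>

lemma boundary_values_clip: "boundary_values (clip G)"
proof -
  have "clip G i j = v" if "lowest i j = v" "highest i j = v" for i j v
    using that by (simp add: clip_def)
  then show ?thesis
    using boundary_values_lowest boundary_values_highest unfolding boundary_values_def by auto
qed

definition violates_only :: "(nat \<Rightarrow> nat \<Rightarrow> real) \<Rightarrow> equation \<Rightarrow> bool" where
  "violates_only H e \<longleftrightarrow> boundary_values H \<and> rhs e < lhs H e \<and>
     (\<forall>e'\<in>facet_equations - {e}. lhs H e' \<le> rhs e')"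

lemma violates_only_clip:
  assumes "rhs e < lhs (clip G) e"
    and "\<And>e'. e' \<in> unit_equations \<Longrightarrow> e' \<noteq> e \<Longrightarrow> lhs G e' \<le> rhs e'"
  shows "violates_only (clip G) e"
  unfolding violates_only_def
proof (intro conjI ballI)
  fix e' assume "e' \<in> facet_equations - {e}"
  then show "lhs (clip G) e' \<le> rhs e'"
    using assms(2) facet_equations_subset by (intro clip_ineq) auto
qed (use assms(1) boundary_values_clip in auto)

text \<open>The matrices \<open>G\<close> below are extremal among those that satisfy every inequality of the infinite
  grid but one: up to sign and a constant, their entries are the lengths of shortest paths in the grid
  with one edge removed.\<close>

lemma violates_only_row_lower:
  assumes i: "1 \<le> i" and lt: "lowest i j < highest (i - 1) j"
    and le: "lowest i j \<le> highest i j" "lowest (i - 1) j \<le> lowest i j"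
  shows "\<exists>H. violates_only H (RowEq i j 0)"
proof -
  define G where "G a b = lowest i j + max 0 (real a - real i) + max 0 (real b - real j)
    + of_bool (a < i \<and> b = j)" for a b
  have "violates_only (clip G) (RowEq i j 0)"
  proof (rule violates_only_clip)
    \<comment> \<open>The entries are integers, so the strict gap is at least 1. That is room for
      \<open>clip\<close> to keep \<open>G (i - 1) j\<close>, which is one above
      \<open>G i j = lowest i j\<close>.\<close>
    have "lowest i j + 1 \<le> highest (i - 1) j"
      using lt unfolding lowest_def highest_def of_nat_less_iff nat_less_real_le .
    then show "rhs (RowEq i j 0) < lhs (clip G) (RowEq i j 0)"
      using i le by (auto simp: clip_def G_def)
  next
    fix e' assume e': "e' \<in> unit_equations" "e' \<noteq> RowEq i j 0"
    from e'(1) consider a b c where "e' = RowEq (Suc a) b c" "c = 0 \<or> c = 1"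
      | a b c where "e' = ColEq a (Suc b) c" "c = 0 \<or> c = 1"
      by (auto simp: unit_equations_def Suc_le_eq gr0_conv_Suc)
    then show "lhs G e' \<le> rhs e'"
    proof cases
      case (1 a b c)
      consider "Suc a < i" | "Suc a = i" "b \<noteq> j" | "Suc a = i" "b = j" | "i < Suc a" by linarith
      then show ?thesis
        using 1 e'(2) by cases (auto simp: G_def max_def)
    next
      case (2 a b c)
      consider "Suc b < j" | "Suc b = j" | "b = j" | "j < b" by linarith
      then show ?thesis
        using 2 e'(2) by cases (cases "a < i"; auto simp: G_def max_def)+
    qed
  qed
  then show ?thesis by blast
qed

lemma violates_only_col_lower:
  assumes j: "1 \<le> j" and lt: "lowest i j < highest i (j - 1)"
    and le: "lowest i j \<le> highest i j" "lowest i (j - 1) \<le> lowest i j"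
  shows "\<exists>H. violates_only H (ColEq i j 0)"
proof -
  define G where "G a b = lowest i j + max 0 (real a - real i) + max 0 (real b - real j)
    + of_bool (b < j \<and> a = i)" for a b
  have "violates_only (clip G) (ColEq i j 0)"
  proof (rule violates_only_clip)
    have "lowest i j + 1 \<le> highest i (j - 1)"
      using lt unfolding lowest_def highest_def of_nat_less_iff nat_less_real_le .
    then show "rhs (ColEq i j 0) < lhs (clip G) (ColEq i j 0)"
      using j le by (auto simp: clip_def G_def)
  next
    fix e' assume e': "e' \<in> unit_equations" "e' \<noteq> ColEq i j 0"
    from e'(1) consider a b c where "e' = RowEq (Suc a) b c" "c = 0 \<or> c = 1"
      | a b c where "e' = ColEq a (Suc b) c" "c = 0 \<or> c = 1"
      by (auto simp: unit_equations_def Suc_le_eq gr0_conv_Suc)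
    then show "lhs G e' \<le> rhs e'"
    proof cases
      case (1 a b c)
      consider "Suc a < i" | "Suc a = i" | "a = i" | "i < a" by linarith
      then show ?thesis
        using 1 e'(2) by cases (cases "b < j"; auto simp: G_def max_def)+
    next
      case (2 a b c)
      consider "Suc b < j" | "Suc b = j" "a \<noteq> i" | "Suc b = j" "a = i" | "j < Suc b" by linarith
      then show ?thesis
        using 2 e'(2) by cases (auto simp: G_def max_def)
    qed
  qed
  then show ?thesis by blast
qed

text \<open>The violated bound allows a rise of 1, so the entries at \<open>(i - 1, j)\<close> and
  \<open>(i, j)\<close> must end up 2 apart; hence the larger gap in \<open>lt\<close>.\<close>

lemma violates_only_row_upper:
  assumes i: "1 \<le> i" and lt: "lowest (i - 1) j + 1 < highest i j"
    and le: "lowest i j \<le> highest i j"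
  shows "\<exists>H. violates_only H (RowEq i j 1)"
proof -
  define G where "G a b = highest i j + min 0 (real a - real i) + min 0 (real b - real j)
    - of_bool (a < i \<and> b = j)" for a b
  have "violates_only (clip G) (RowEq i j 1)"
  proof (rule violates_only_clip)
    have gap: "real x + 2 \<le> real y" if "real x + 1 < real y" for x y :: nat
    proof -
      have "Suc x < y" using that by linarith
      then show ?thesis by linarith
    qed
    have "lowest (i - 1) j + 2 \<le> highest i j"
      using lt gap unfolding lowest_def highest_def by blast
    then show "rhs (RowEq i j 1) < lhs (clip G) (RowEq i j 1)"
      using i le by (auto simp: clip_def G_def)
  next
    fix e' assume e': "e' \<in> unit_equations" "e' \<noteq> RowEq i j 1"
    from e'(1) consider a b c where "e' = RowEq (Suc a) b c" "c = 0 \<or> c = 1"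
      | a b c where "e' = ColEq a (Suc b) c" "c = 0 \<or> c = 1"
      by (auto simp: unit_equations_def Suc_le_eq gr0_conv_Suc)
    then show "lhs G e' \<le> rhs e'"
    proof cases
      case (1 a b c)
      consider "Suc a < i" | "Suc a = i" "b \<noteq> j" | "Suc a = i" "b = j" | "i < Suc a" by linarith
      then show ?thesis
        using 1 e'(2) by cases (auto simp: G_def min_def)
    next
      case (2 a b c)
      consider "Suc b < j" | "Suc b = j" | "b = j" | "j < b" by linarith
      then show ?thesis
        using 2 e'(2) by cases (cases "a < i"; auto simp: G_def min_def)+
    qed
  qed
  then show ?thesis by blast
qed

lemma violates_only_col_upper:
  assumes j: "1 \<le> j" and lt: "lowest i (j - 1) + 1 < highest i j"
    and le: "lowest i j \<le> highest i j"
  shows "\<exists>H. violates_only H (ColEq i j 1)"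
proof -
  define G where "G a b = highest i j + min 0 (real a - real i) + min 0 (real b - real j)
    - of_bool (b < j \<and> a = i)" for a b
  have "violates_only (clip G) (ColEq i j 1)"
  proof (rule violates_only_clip)
    have gap: "real x + 2 \<le> real y" if "real x + 1 < real y" for x y :: nat
    proof -
      have "Suc x < y" using that by linarith
      then show ?thesis by linarith
    qed
    have "lowest i (j - 1) + 2 \<le> highest i j"
      using lt gap unfolding lowest_def highest_def by blast
    then show "rhs (ColEq i j 1) < lhs (clip G) (ColEq i j 1)"
      using j le by (auto simp: clip_def G_def)
  next
    fix e' assume e': "e' \<in> unit_equations" "e' \<noteq> ColEq i j 1"
    from e'(1) consider a b c where "e' = RowEq (Suc a) b c" "c = 0 \<or> c = 1"
      | a b c where "e' = ColEq a (Suc b) c" "c = 0 \<or> c = 1"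
      by (auto simp: unit_equations_def Suc_le_eq gr0_conv_Suc)
    then show "lhs G e' \<le> rhs e'"
    proof cases
      case (1 a b c)
      consider "Suc a < i" | "Suc a = i" | "a = i" | "i < a" by linarith
      then show ?thesis
        using 1 e'(2) by cases (cases "b < j"; auto simp: G_def min_def)+
    next
      case (2 a b c)
      consider "Suc b < j" | "Suc b = j" "a \<noteq> i" | "Suc b = j" "a = i" | "j < Suc b" by linarith
      then show ?thesis
        using 2 e'(2) by cases (auto simp: G_def min_def)
    qed
  qed
  then show ?thesis by blast
qed

section \<open>Changing one entry of an extreme matrix\<close>

lemma violates_only_lowest:
  assumes p: "p \<in> {2..n-2}" and q: "q \<in> {1..k-1}"
    and H: "H = (\<lambda>a b. lowest a b - of_bool (a = p \<and> b = q))"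
    and e: "rhs e < lhs H e"
    and nb: "\<And>e'. e' \<in> {RowEq p q 0, RowEq (Suc p) q 1, ColEq p q 0, ColEq p (Suc q) 1} - {e} \<Longrightarrow>
      e' \<in> facet_equations \<Longrightarrow> lhs H e' \<le> rhs e'"
  shows "violates_only H e"
  unfolding violates_only_def
proof (intro conjI ballI)
  show "boundary_values H"
    using boundary_values_lowest p q n k unfolding boundary_values_def H by auto
next
  fix e' assume e': "e' \<in> facet_equations - {e}"
  show "lhs H e' \<le> rhs e'"
  \<comment> \<open>These four are the bounds with entry \<open>(p, q)\<close> on the larger side,
    the only ones that lowering it can break.\<close>
  proof (cases "e' \<in> {RowEq p q 0, RowEq (Suc p) q 1, ColEq p q 0, ColEq p (Suc q) 1}")
    case True
    then show ?thesis using nb e' by blast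
  next
    case False
    have u: "e' \<in> unit_equations" using e' facet_equations_subset by auto
    then have le: "lhs lowest e' \<le> rhs e'" by (rule lowest_ineq)
    from u consider a b c where "e' = RowEq (Suc a) b c" "c = 0 \<or> c = 1"
      | a b c where "e' = ColEq a (Suc b) c" "c = 0 \<or> c = 1"
      by (auto simp: unit_equations_def Suc_le_eq gr0_conv_Suc)
    then show ?thesis
      using False le by cases (auto simp: H of_bool_def)
  qed
qed (fact e)

lemma violates_only_highest:
  assumes p: "p \<in> {2..n-2}" and q: "q \<in> {1..k-1}"
    and H: "H = (\<lambda>a b. highest a b + of_bool (a = p \<and> b = q))"
    and e: "rhs e < lhs H e"
    and nb: "\<And>e'. e' \<in> {RowEq (Suc p) q 0, RowEq p q 1, ColEq p (Suc q) 0, ColEq p q 1} - {e} \<Longrightarrow>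
      e' \<in> facet_equations \<Longrightarrow> lhs H e' \<le> rhs e'"
  shows "violates_only H e"
  unfolding violates_only_def
proof (intro conjI ballI)
  show "boundary_values H"
    using boundary_values_highest p q n k unfolding boundary_values_def H by auto
next
  fix e' assume e': "e' \<in> facet_equations - {e}"
  show "lhs H e' \<le> rhs e'"
  \<comment> \<open>Raising the entry can only break the four bounds with \<open>(p, q)\<close> on
    the smaller side.\<close>
  proof (cases "e' \<in> {RowEq (Suc p) q 0, RowEq p q 1, ColEq p (Suc q) 0, ColEq p q 1}")
    case True
    then show ?thesis using nb e' by blast
  next
    case False
    have u: "e' \<in> unit_equations" using e' facet_equations_subset by auto
    then have le: "lhs highest e' \<le> rhs e'" by (rule highest_ineq)
    from u consider a b c where "e' = RowEq (Suc a) b c" "c = 0 \<or> c = 1"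
      | a b c where "e' = ColEq a (Suc b) c" "c = 0 \<or> c = 1"
      by (auto simp: unit_equations_def Suc_le_eq gr0_conv_Suc)
    then show ?thesis
      using False le by cases (auto simp: H of_bool_def)
  qed
qed (fact e)

lemma lowest_mono: "i \<le> i' \<Longrightarrow> j \<le> j' \<Longrightarrow> lowest i j \<le> lowest i' j'"
  unfolding lowest_def of_nat_le_iff by (intro diff_le_mono add_mono div_le_mono)

text \<open>Clipping works where \<open>lowest\<close> and \<open>highest\<close> leave enough room
  at the two entries compared. For the \<open>ColEq\<close> equations in columns 1 and
  \<open>k\<close> they do not, and one entry of an extreme matrix is changed instead.\<close>

lemma exists_violates_only:
  assumes "e \<in> facet_equations"
  shows "\<exists>H. violates_only H e"
proof -
  consider (R0) i j where "e = RowEq i j 0" "i \<in> {3..n-2}" "j \<in> {1..k - 1 - of_bool (even i)}"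
    | (R1) i j where "e = RowEq i j 1" "i \<in> {4..n-3}" "j \<in> {2..k - 1 - of_bool (odd i)}"
    | (K0) i j where "e = ColEq i j 0" "i \<in> {2..n-4}" "j \<in> {2..k-1}"
    | (K0_first) "e = ColEq 2 1 0"
    | (K0_last) i where "e = ColEq i k 0" "i \<in> {2..n-4}" "odd i"
    | (K1) i j where "e = ColEq i j 1" "i \<in> {4..n-2}" "j \<in> {2..k-1}"
    | (K1_first) "e = ColEq (n - 2) 1 1"
    | (K1_last) i where "e = ColEq i k 1" "i \<in> {4..n-2}" "even i"
  proof -
    have "j \<in> {2..k-1} \<or> odd i \<and> j = k" if "j \<in> {2..k - of_bool (even i)}" for i j
      using that by (cases "even i") auto
    moreover have "j \<in> {2..k-1} \<or> even i \<and> j = k" if "j \<in> {2..k - of_bool (odd i)}" for i j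
      using that by (cases "even i") auto
    ultimately show thesis
      using assms that unfolding facet_equations_def by blast
  qed
  then show ?thesis
  proof cases
    case (R0 i j)
    \<comment> \<open>At \<open>j = k - 1\<close> with even \<open>i\<close> both sides would be
      \<open>i div 2 - 1\<close>, matching the shorter column range for even
      \<open>i\<close>.\<close>
    have "i div 2 + j - k < min j ((i - 1) div 2)"
      using R0 n k by (cases "even i") (auto elim!: evenE oddE)
    then show ?thesis
      unfolding R0 using R0 n k
      by (intro violates_only_row_lower lowest_le_highest lowest_mono) (auto simp: lowest_def highest_def)
  next
    case (R1 i j)
    \<comment> \<open>Strictness would fail at \<open>j = 1\<close>, where the right side is 1, and
      at \<open>j = k - 1\<close> for odd \<open>i\<close>, where both sides are
      \<open>i div 2\<close>.\<close>
    have "Suc ((i - 1) div 2 + j - k) < min j (i div 2)"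
      using R1 n k by (cases "even i") (auto elim!: evenE oddE)
    then have "real (Suc ((i - 1) div 2 + j - k)) < real (min j (i div 2))"
      unfolding of_nat_less_iff .
    then show ?thesis
      unfolding R1 using R1 n k
      by (intro violates_only_row_upper lowest_le_highest) (auto simp: lowest_def highest_def)
  next
    case (K0 i j)
    have "i div 2 + j - k < min (j - 1) (i div 2)"
      using K0 n k by (cases "even i") (auto elim!: evenE oddE)
    then show ?thesis
      unfolding K0 using K0 n k
      by (intro violates_only_col_lower lowest_le_highest lowest_mono) (auto simp: lowest_def highest_def)
  next
    case (K1 i j)
    have "Suc (i div 2 + (j - 1) - k) < min j (i div 2)"
      using K1 n k by (cases "even i") (auto elim!: evenE oddE)
    then have "real (Suc (i div 2 + (j - 1) - k)) < real (min j (i div 2))"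
      unfolding of_nat_less_iff .
    then show ?thesis
      unfolding K1 using K1 n k
      by (intro violates_only_col_upper lowest_le_highest) (auto simp: lowest_def highest_def)
  next
    case K0_first
    \<comment> \<open>Entry \<open>(2, 1)\<close> becomes -1, below the 0 in column 0. The other
      three bounds with it on the larger side are not on the list.\<close>
    have "violates_only (\<lambda>a b. lowest a b - of_bool (a = 2 \<and> b = 1)) e"
      by (rule violates_only_lowest[where p = 2 and q = 1, OF _ _ refl])
        (use K0_first n k in \<open>unfold facet_equations_def, auto simp: lowest_def\<close>)
    then show ?thesis by blast
  next
    case K1_first
    have "violates_only (\<lambda>a b. highest a b + of_bool (a = n - 2 \<and> b = 1)) e"
      by (rule violates_only_highest[where p = "n - 2" and q = 1, OF _ _ refl])
        (use K1_first n k in \<open>unfold facet_equations_def, auto simp: highest_def\<close>)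
    then show ?thesis by blast
  next
    case (K0_last i)
    then obtain m where m: "i = 2 * m + 1" by (blast elim: oddE)
    have mk: "1 \<le> m" "m \<le> k - 2" using K0_last m n by auto
    \<comment> \<open>As \<open>m \<le> k - 2\<close>, row \<open>i\<close> of
      \<open>highest\<close> is constantly \<open>m\<close> from column \<open>k - 2\<close> on, so
      raising column \<open>k - 1\<close> overshoots the fixed value in column
      \<open>k\<close>.\<close>
    have h: "highest i k = real m" "highest i (k - 1) = real m" "highest i (k - 1 - 1) = real m"
      "k - 1 \<noteq> k" "k - 1 - 1 \<noteq> k - 1" "k - 1 \<noteq> 1"
      using m mk k by (auto simp: highest_def)
    let ?H = "\<lambda>a b. highest a b + of_bool (a = i \<and> b = k - 1)"
    have "violates_only ?H e"
    proof (rule violates_only_highest[where p = i and q = "k - 1", OF _ _ refl])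
      show "rhs e < lhs ?H e" using K0_last h by simp
      fix e' assume "e' \<in> {RowEq (Suc i) (k - 1) 0, RowEq i (k - 1) 1, ColEq i (Suc (k - 1)) 0, ColEq i (k - 1) 1} - {e}"
        and "e' \<in> facet_equations"
      \<comment> \<open>Since \<open>i\<close> is odd, the parity terms remove column
        \<open>k - 1\<close> for both row equations.\<close>
      moreover have "RowEq (Suc i) (k - 1) 0 \<notin> facet_equations" "RowEq i (k - 1) 1 \<notin> facet_equations"
        using K0_last k unfolding facet_equations_def by auto
      moreover have "e = ColEq i (Suc (k - 1)) 0" using K0_last k by simp
      ultimately have "e' = ColEq i (k - 1) 1" by blast
      then show "lhs ?H e' \<le> rhs e'" using h by simp
    qed (use K0_last k in auto)
    then show ?thesis by blast
  next
    case (K1_last i)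
    then obtain m where m: "i = 2 * m" by blast
    have mk: "2 \<le> m" "m \<le> k - 1" using K1_last m n by auto
    \<comment> \<open>The entry drops from \<open>m - 1\<close> to \<open>m - 2\<close>, leaving a
      jump of 2 to the fixed value \<open>m\<close> in column \<open>k\<close>.\<close>
    have "violates_only (\<lambda>a b. lowest a b - of_bool (a = i \<and> b = k - 1)) e"
      by (rule violates_only_lowest[where p = i and q = "k - 1", OF _ _ refl])
        (use K1_last m mk n k in \<open>unfold facet_equations_def, auto simp: lowest_def\<close>)
    then show ?thesis by blast
  qed
qed

section \<open>A strictly feasible point\<close>

definition center :: "nat \<Rightarrow> nat \<Rightarrow> real" where
  "center i j = (if i \<le> 1 then 0 else if n - 1 \<le> i then real j
     else (real i - 1) / 2 * (real j / real k) + of_bool (even i) * (real j / real k)\<^sup>2 / 2)"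

lemma boundary_values_center: "boundary_values center"
proof -
  have "center i k = real (i div 2)" if "i \<le> n" for i
    using that k unfolding center_def by (cases "even i") (auto simp: n field_simps elim!: evenE oddE)
  moreover have "center i 0 = 0" for i by (auto simp: center_def)
  moreover have "center 0 j = 0" "center 1 j = 0" "center (n - 1) j = real j" "center n j = real j" for j
    using k unfolding center_def by (auto simp: n)
  ultimately show ?thesis unfolding boundary_values_def by blast
qed

text \<open>Linear rows of slope \<open>i div 2\<close> would give zero steps from even to odd rows.
  The quadratic term in even rows yields row steps \<open>(x + x * x) / 2\<close> and
  \<open>(x - x * x) / 2\<close> with \<open>x = j / k\<close>, both strictly between 0 and
  1.\<close>

lemma center_strict:
  assumes e: "e \<in> facet_equations"
  shows "lhs center e < rhs e"
  using e
proof (cases rule: facet_equations_cases)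
  case (1 i j c)
  define x where "x = real j / real k"
  have x: "0 < x" "x < 1" using 1 k by (auto simp: x_def)
  then have sq: "0 \<le> x\<^sup>2" "x\<^sup>2 < x" by (auto simp: power2_eq_square)
  have "even (i - 1) = odd i" using 1 by auto
  moreover have "\<not> i \<le> 1" "\<not> n - 1 \<le> i" "\<not> i - 1 \<le> 1" "\<not> n - 1 \<le> i - 1" using 1 n by auto
  ultimately have eq: "center i j - center (i - 1) j = (if even i then x / 2 + x\<^sup>2 / 2 else x / 2 - x\<^sup>2 / 2)"
    using 1 by (auto simp: center_def x_def[symmetric] of_nat_diff field_simps)
  have "0 < center i j - center (i - 1) j \<and> center i j - center (i - 1) j < 1"
    unfolding eq using x sq by (cases "even i") (simp_all only: if_True if_False, linarith+)
  then show ?thesis using 1 by auto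
next
  case (2 i j c)
  define x d where "x = real j / real k" and "d = 1 / real k"
  have d: "0 < d" "d \<le> x" "x \<le> 1" "d * real k = 1" using 2 k by (auto simp: x_def d_def field_simps)
  have x': "real (j - 1) / real k = x - d" using 2 by (simp add: x_def d_def of_nat_diff diff_divide_distrib)
  have inner: "\<not> i \<le> 1" "\<not> n - 1 \<le> i" using 2 n by auto
  have "center i j = (real i - 1) / 2 * x + of_bool (even i) * x\<^sup>2 / 2"
    using inner by (simp add: center_def x_def)
  moreover have "center i (j - 1) = (real i - 1) / 2 * (x - d) + of_bool (even i) * (x - d)\<^sup>2 / 2"
    unfolding center_def x' using inner by simp
  ultimately have eq: "center i j - center i (j - 1) =
      (real i - 1) / 2 * d + (if even i then d * (2 * x - d) / 2 else 0)"
    by (auto simp: power2_eq_square field_simps)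
  have i: "0 < (real i - 1) / 2 * d" using 2 d by auto
  have "0 < center i j - center i (j - 1) \<and> center i j - center i (j - 1) < 1"
  proof (cases "even i")
    case True
    \<comment> \<open>\<open>n - 2\<close> is odd, so even rows stop at \<open>2 * k - 2\<close>.
      The linear part then leaves slack \<open>3 / 2 * d\<close>, and the quadratic part uses at
      most \<open>d\<close> of it.\<close>
    have "i \<noteq> n - 2" using True n k by auto
    then have "i \<le> 2 * k - 2" using 2 n by auto
    then have "(real i - 1) / 2 * d \<le> (real k - 3 / 2) * d"
      using d k by (intro mult_right_mono) (auto simp: of_nat_diff)
    also have "\<dots> = 1 - 3 / 2 * d" using d by (simp add: algebra_simps)
    finally have "(real i - 1) / 2 * d \<le> 1 - 3 / 2 * d" .
    moreover have "0 < d * (2 * x - d)" using d by auto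
    moreover have "d * (2 * x - d) \<le> d * 2"
      using d by (intro mult_left_mono) auto
    ultimately show ?thesis using d(1) i unfolding eq if_P[OF True] by linarith
  next
    case False
    have "i \<le> 2 * k - 1" using 2 n by auto
    then have "(real i - 1) / 2 * d \<le> (real k - 1) * d"
      using d k by (intro mult_right_mono) (auto simp: of_nat_diff)
    also have "\<dots> = 1 - d" using d by (simp add: algebra_simps)
    finally show ?thesis using d(1) i unfolding eq if_not_P[OF False] by linarith
  qed
  then show ?thesis using 2 by auto
qed

section \<open>The core polytope in terms of corner sums\<close>

definition corner :: "real ^ 'k ^ 'n \<Rightarrow> nat \<Rightarrow> nat \<Rightarrow> real" where
  "corner Y i j = (\<Sum>i'=1..i. \<Sum>j'=1..j. Y $ row_ix i' $ col_ix j')"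

definition of_corner :: "(nat \<Rightarrow> nat \<Rightarrow> real) \<Rightarrow> real ^ 'k ^ 'n" where
  "of_corner H = (\<chi> p q. let i = the_inv_into {1..n} row_ix p; j = the_inv_into {1..k} col_ix q
     in (H i j - H (i - 1) j) - (H i (j - 1) - H (i - 1) (j - 1)))"

lemma corner_0 [simp]: "corner Y 0 j = 0" "corner Y i 0 = 0"
  by (simp_all add: corner_def)

lemma row_sum_conv_corner: "1 \<le> i \<Longrightarrow> row_sum row_ix col_ix i j Y = corner Y i j - corner Y (i - 1) j"
  by (cases i) (simp_all add: corner_def row_sum_def)

lemma corner_conv_col_sum: "corner Y i j = (\<Sum>j'=1..j. col_sum row_ix col_ix i j' Y)"
  unfolding corner_def col_sum_def by (rule sum.swap)

lemma col_sum_conv_corner: "1 \<le> j \<Longrightarrow> col_sum row_ix col_ix i j Y = corner Y i j - corner Y i (j - 1)"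
  by (cases j) (simp_all add: corner_conv_col_sum)

lemma of_corner_nth:
  assumes "i \<in> {1..n}" "j \<in> {1..k}"
  shows "of_corner H $ row_ix i $ col_ix j = (H i j - H (i - 1) j) - (H i (j - 1) - H (i - 1) (j - 1))"
  using assms row_ix col_ix by (simp add: of_corner_def the_inv_into_f_f bij_betw_def)

lemma row_sum_of_corner:
  assumes "i \<in> {1..n}" "j \<le> k"
  shows "row_sum row_ix col_ix i j (of_corner H) = (H i j - H (i - 1) j) - (H i 0 - H (i - 1) 0)"
  using assms(2)
proof (induction j)
  case (Suc j)
  then show ?case using of_corner_nth[OF assms(1), of "Suc j" H] by (simp add: row_sum_def)
qed (simp add: row_sum_def)

text \<open>Mixed differences telescope, and the boundary values remove the leftover terms from row
  0 and column 0.\<close>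

lemma corner_of_corner:
  assumes H: "boundary_values H" and "i \<le> n" "j \<le> k"
  shows "corner (of_corner H) i j = H i j"
  using assms(2)
proof (induction i)
  case 0
  then show ?case using H assms(3) by (simp add: boundary_values_def)
next
  case (Suc i)
  then have "H (Suc i) 0 = 0" "H i 0 = 0" using H by (auto simp: boundary_values_def)
  then show ?case
    using row_sum_of_corner[of "Suc i" j H] row_sum_conv_corner[of "Suc i" j "of_corner H"] Suc assms(3) by simp
qed

lemma matrix_eqI:
  fixes Y Z :: "real ^ 'k ^ 'n"
  assumes "\<And>i j. i \<in> {1..n} \<Longrightarrow> j \<in> {1..k} \<Longrightarrow> Y $ row_ix i $ col_ix j = Z $ row_ix i $ col_ix j"
  shows "Y = Z"
proof -
  have "Y $ p $ q = Z $ p $ q" for p q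
  proof -
    have "p \<in> row_ix ` {1..n}" "q \<in> col_ix ` {1..k}" using row_ix col_ix by (auto simp: bij_betw_def)
    then show ?thesis using assms by blast
  qed
  then show ?thesis by (simp add: vec_eq_iff)
qed

lemma nth_conv_corner:
  assumes "i \<in> {1..n}" "j \<in> {1..k}"
  shows "Y $ row_ix i $ col_ix j = (corner Y i j - corner Y (i - 1) j) - (corner Y i (j - 1) - corner Y (i - 1) (j - 1))"
proof -
  have "Y $ row_ix i $ col_ix j = row_sum row_ix col_ix i j Y - row_sum row_ix col_ix i (j - 1) Y"
    using assms(2) by (cases j) (auto simp: row_sum_def)
  then show ?thesis using assms by (simp add: row_sum_conv_corner)
qed

lemma linear_corner: "linear (\<lambda>Y. corner Y i j)"
  unfolding corner_def
  by (intro linear_compose_sum ballI linearI) simp_all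

lemma continuous_corner: "continuous_on UNIV (\<lambda>Y. corner Y i j)"
  using linear_corner linear_conv_bounded_linear linear_continuous_on by blast

lemma boundary_values_cong:
  assumes "\<And>i j. i \<le> n \<Longrightarrow> j \<le> k \<Longrightarrow> H i j = H' i j" and "boundary_values H"
  shows "boundary_values H'"
proof -
  have "H' i j = H i j" if "i \<le> n" "j \<le> k" for i j using assms(1) that by simp
  then show ?thesis using assms(2) n unfolding boundary_values_def by simp
qed

lemma unit_steps_cong:
  assumes "\<And>i j. i \<le> n \<Longrightarrow> j \<le> k \<Longrightarrow> H i j = H' i j" and "unit_steps H"
  shows "unit_steps H'"
proof -
  have eq: "H' i j = H i j" if "i \<le> n" "j \<le> k" for i j using assms(1) that by simp
  show ?thesis
    unfolding unit_steps_def
  proof (intro ballI)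
    fix i j assume ij: "i \<in> {1..n}" "j \<in> {1..k}"
    then have "H' i j = H i j" "H' (i - 1) j = H (i - 1) j" "H' i (j - 1) = H i (j - 1)" by (auto intro!: eq)
    then show "H' i j - H' (i - 1) j \<in> {0..1} \<and> H' i j - H' i (j - 1) \<in> {0..1}"
      using assms(2) ij unfolding unit_steps_def by simp
  qed
qed

section \<open>The relaxed polytope and its extreme points\<close>

definition boundary_space :: "(real ^ 'k ^ 'n) set" where
  "boundary_space = {Y. boundary_values (corner Y)}"

definition step_polytope :: "(real ^ 'k ^ 'n) set" where
  "step_polytope = {Y \<in> boundary_space. unit_steps (corner Y)}"

lemma of_corner_in_boundary_space: "boundary_values H \<Longrightarrow> of_corner H \<in> boundary_space"
  unfolding boundary_space_def using boundary_values_cong[of H "corner (of_corner H)"] corner_of_corner by auto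

lemma of_corner_in_step_polytope: "boundary_values H \<Longrightarrow> unit_steps H \<Longrightarrow> of_corner H \<in> step_polytope"
  unfolding step_polytope_def
  using of_corner_in_boundary_space unit_steps_cong[of H "corner (of_corner H)"] corner_of_corner by auto

lemma corner_combination: "corner (u *\<^sub>R Y + v *\<^sub>R Z) i j = u * corner Y i j + v * corner Z i j"
  using linear_add[OF linear_corner, of "u *\<^sub>R Y" "v *\<^sub>R Z" i j]
    linear_scale[OF linear_corner, of u Y i j] linear_scale[OF linear_corner, of v Z i j] by simp

lemma affine_boundary_space: "affine boundary_space"
proof -
  have "u * a + v * a = a" if "u + v = 1" for u v a :: real
    using that by (metis distrib_right mult_1)
  then show ?thesis
    unfolding affine_def boundary_space_def boundary_values_def by (auto simp: corner_combination)
qed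

lemma convex_step_polytope: "convex step_polytope"
proof -
  have "corner (u *\<^sub>R Y + v *\<^sub>R Z) i j - corner (u *\<^sub>R Y + v *\<^sub>R Z) i' j' =
      u *\<^sub>R (corner Y i j - corner Y i' j') + v *\<^sub>R (corner Z i j - corner Z i' j')" for u v Y Z i j i' j'
    by (simp add: corner_combination algebra_simps)
  moreover have "u *\<^sub>R a + v *\<^sub>R b \<in> {0..1}" if "0 \<le> u" "0 \<le> v" "u + v = 1" "a \<in> {0..1}" "b \<in> {0..1}"
    for u v a b :: real
    using convexD[OF convex_real_interval(5)] that by blast
  ultimately have "convex {Y. unit_steps (corner Y)}"
    unfolding convex_def unit_steps_def by (simp del: atLeastAtMost_iff real_scaleR_def)
  then show ?thesis
    using affine_imp_convex[OF affine_boundary_space] unfolding step_polytope_def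
    by (simp add: Collect_conj_eq convex_Int)
qed

text \<open>Each entry is a difference of two row steps between 0 and 1, which bounds the polytope.
  Compactness is needed for the Krein-Milman theorem.\<close>

lemma compact_step_polytope: "compact step_polytope"
proof -
  have "closed {Y. boundary_values (corner Y)}"
    unfolding boundary_values_def
    by (intro closed_Collect_conj closed_Collect_all closed_Collect_imp open_Collect_const
        closed_Collect_eq continuous_corner continuous_intros)
  moreover have "closed {Y. unit_steps (corner Y)}"
    unfolding unit_steps_def Ball_def atLeastAtMost_iff[where 'a = real]
    by (intro closed_Collect_conj closed_Collect_all closed_Collect_imp open_Collect_const
        closed_Collect_le continuous_corner continuous_intros)
  ultimately have "closed step_polytope"
    unfolding step_polytope_def boundary_space_def by (simp add: Collect_conj_eq closed_Int)
  moreover have "bounded step_polytope"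
  proof (rule boundedI)
    fix Y assume "Y \<in> step_polytope"
    then have Y: "unit_steps (corner Y)" by (simp add: step_polytope_def)
    have "\<bar>Y $ p $ q\<bar> \<le> 1" for p q
    proof -
      have "p \<in> row_ix ` {1..n}" "q \<in> col_ix ` {1..k}" using row_ix col_ix by (auto simp: bij_betw_def)
      then obtain i j where ij: "i \<in> {1..n}" "j \<in> {1..k}" "p = row_ix i" "q = col_ix j" by blast
      have step: "0 \<le> corner Y i j - corner Y (i - 1) j" "corner Y i j - corner Y (i - 1) j \<le> 1"
        if "j \<le> k" for j
        using Y ij(1) that unfolding unit_steps_def by (cases "j = 0"; force)+
      show ?thesis
        using step[of j] step[of "j - 1"] ij nth_conv_corner[of i j Y]
        by (simp add: le_diff_conv abs_le_iff)
    qed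
    then have "(\<Sum>q\<in>UNIV. \<bar>Y $ p $ q\<bar>) \<le> (\<Sum>q\<in>(UNIV :: 'k set). 1)" for p
      by (intro sum_mono) auto
    then have row: "norm (Y $ p) \<le> (\<Sum>q\<in>(UNIV :: 'k set). 1)" for p
      by (rule order_trans[OF norm_le_l1_cart])
    have "norm Y \<le> (\<Sum>p\<in>UNIV. norm (Y $ p))"
      unfolding norm_vec_def by (rule L2_set_le_sum) simp
    also have "\<dots> \<le> (\<Sum>p\<in>(UNIV :: 'n set). \<Sum>q\<in>(UNIV :: 'k set). 1)"
      by (intro sum_mono row)
    finally show "norm Y \<le> (\<Sum>p\<in>(UNIV :: 'n set). \<Sum>q\<in>(UNIV :: 'k set). 1)" .
  qed
  ultimately show ?thesis by (simp add: compact_eq_bounded_closed)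
qed

text \<open>Both perturbations by \<open>wobble\<close> stay in the polytope and have midpoint
  \<open>Y\<close>. Extremality makes them equal, so \<open>wobble\<close> vanishes at each corner
  sum.\<close>

lemma extreme_point_corner_integral:
  assumes Y: "Y extreme_point_of step_polytope" and "i \<le> n" "j \<le> k"
  shows "corner Y i j \<in> \<int>"
proof -
  have mem: "boundary_values (corner Y)" "unit_steps (corner Y)"
    using Y by (auto simp: extreme_point_of_def step_polytope_def boundary_space_def)
  define shift where "shift s i j = corner Y i j + s * wobble (corner Y i j)" for s i j
  \<comment> \<open>Boundary values are integers, where \<open>wobble\<close> is 0.\<close>
  have "boundary_values (shift s)" for s
    using mem(1) by (simp add: boundary_values_def shift_def wobble_eq_0_iff)
  moreover have "unit_steps (shift s)" if s: "\<bar>s\<bar> = 1" for s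
    unfolding unit_steps_def
  proof (intro ballI conjI)
    fix i j assume ij: "i \<in> {1..n}" "j \<in> {1..k}"
    have bounds: "x + s * wobble x - (y + s * wobble y) \<in> {0..1}" if "x - y \<in> {0..1}" for x y
      using wobble_preserves_difference_bound[of x y 1 s] wobble_preserves_difference_bound[of y x 0 s] s that
      by simp
    show "shift s i j - shift s (i - 1) j \<in> {0..1}" "shift s i j - shift s i (j - 1) \<in> {0..1}"
      unfolding shift_def using mem(2) ij by (auto simp only: unit_steps_def intro!: bounds)
  qed
  ultimately have "of_corner (shift 1) \<in> step_polytope" "of_corner (shift (-1)) \<in> step_polytope"
    by (auto intro!: of_corner_in_step_polytope)
  moreover have "Y = midpoint (of_corner (shift 1)) (of_corner (shift (-1)))"
  proof (rule matrix_eqI)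
    fix i j assume ij: "i \<in> {1..n}" "j \<in> {1..k}"
    have "midpoint (of_corner (shift 1)) (of_corner (shift (-1))) $ row_ix i $ col_ix j =
        (of_corner (shift 1) $ row_ix i $ col_ix j + of_corner (shift (-1)) $ row_ix i $ col_ix j) / 2"
      by (simp add: midpoint_def)
    then show "Y $ row_ix i $ col_ix j =
        midpoint (of_corner (shift 1)) (of_corner (shift (-1))) $ row_ix i $ col_ix j"
      using nth_conv_corner[OF ij, of Y] ij by (simp add: of_corner_nth shift_def)
  qed
  ultimately have "of_corner (shift 1) = of_corner (shift (-1))"
    using Y midpoint_in_open_segment unfolding extreme_point_of_def by metis
  then have "shift 1 i j = shift (-1) i j"
    using \<open>\<And>s. boundary_values (shift s)\<close> assms(2,3) corner_of_corner by metis
  then have "wobble (corner Y i j) = 0" by (simp add: shift_def)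
  then show ?thesis by (simp add: wobble_eq_0_iff)
qed

section \<open>VSASM cores as the integral points\<close>

lemma VSASM_prefix_sums:
  assumes "VSASM n X"
  shows "i \<in> {1..n} \<Longrightarrow> j \<le> n \<Longrightarrow> (\<Sum>j'=1..j. X i j') \<in> {0, 1}"
    and "i \<in> {1..n} \<Longrightarrow> (\<Sum>j'=1..n. X i j') = 1"
    and "j \<in> {1..n} \<Longrightarrow> i \<le> n \<Longrightarrow> (\<Sum>i'=1..i. X i' j) \<in> {0, 1}"
    and "j \<in> {1..n} \<Longrightarrow> (\<Sum>i'=1..n. X i' j) = 1"
proof -
  have X: "X i j \<in> {0, 1, -1}" if "i \<in> {1..n}" "j \<in> {1..n}" for i j
    using assms that unfolding VSASM_def ASM_def by blast
  have row: "alternating_line n (\<lambda>j. X i j)" and col: "alternating_line n (\<lambda>j. X j i)" if "i \<in> {1..n}" for i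
    using assms that unfolding VSASM_def ASM_def by blast+
  show "i \<in> {1..n} \<Longrightarrow> j \<le> n \<Longrightarrow> (\<Sum>j'=1..j. X i j') \<in> {0, 1}"
    "i \<in> {1..n} \<Longrightarrow> (\<Sum>j'=1..n. X i j') = 1"
    using row[of i] alternating_line_iff[of n "\<lambda>j. X i j"] X by blast+
  show "j \<in> {1..n} \<Longrightarrow> i \<le> n \<Longrightarrow> (\<Sum>i'=1..i. X i' j) \<in> {0, 1}"
    "j \<in> {1..n} \<Longrightarrow> (\<Sum>i'=1..n. X i' j) = 1"
    using col[of j] alternating_line_iff[of n "\<lambda>i. X i j"] X by blast+
qed

text \<open>By symmetry twice the left half plus the middle entry is 1, so the middle entry is 1 or
  -1. Partial sums of the middle column in 0 and 1 force it to alternate starting with 1, which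
  fixes the left half.\<close>

lemma VSASM_row_sum_middle:
  assumes X: "VSASM n X" and i: "i \<in> {1..n}"
  shows "(\<Sum>j'=1..k. X i j') = of_bool (even i)"
proof -
  have sym: "2 * (\<Sum>j'=1..k. X a j') + X a (k + 1) = 1" if "a \<in> {1..n}" for a
  proof -
    have "(\<Sum>j'=k+2..n. X a j') = (\<Sum>j'=1..k. X a j')"
    proof (rule sum.reindex_bij_witness[of _ "\<lambda>j. n + 1 - j" "\<lambda>j. n + 1 - j"])
      fix j assume "j \<in> {k+2..n}"
      then show "X a (n + 1 - j) = X a j" using X that unfolding VSASM_def by auto
    qed (auto simp: n)
    moreover have "{1..n} = {1..k} \<union> ({k+1} \<union> {k+2..n})" using n by auto
    moreover have "sum (X a) ({1..k} \<union> ({k+1} \<union> {k+2..n})) = sum (X a) {1..k} + (X a (k + 1) + sum (X a) {k+2..n})"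
      by (subst sum.union_disjoint, simp, simp, force)+ simp
    ultimately show ?thesis using VSASM_prefix_sums(2)[OF X that] by simp
  qed
  have "(\<Sum>a=1..m. X a (k + 1)) = of_bool (odd m)" if "m \<le> n" for m
    using that
  proof (induction m)
    case (Suc m)
    have "X (Suc m) (k + 1) \<in> {1, -1}"
      using sym[of "Suc m"] VSASM_prefix_sums(1)[OF X, of "Suc m" k] Suc.prems n by auto
    moreover have "(\<Sum>a=1..Suc m. X a (k + 1)) \<in> {0, 1}"
      using VSASM_prefix_sums(3)[OF X, of "k + 1" "Suc m"] Suc.prems n by auto
    ultimately show ?case using Suc by auto
  qed simp
  from this[of i] this[of "i - 1"] i
  have "X i (k + 1) = of_bool (odd i) - of_bool (odd (i - 1))"
    by (cases i) auto
  then show ?thesis using sym[OF i] i by (cases "even i") auto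
qed

lemma VSASM_cores_subset: "VSASM_cores n row_ix col_ix \<subseteq> step_polytope"
proof
  fix Y assume "Y \<in> VSASM_cores n row_ix col_ix"
  then obtain X where X: "VSASM n X" and Y: "\<And>i j. i \<in> {1..n} \<Longrightarrow> j \<in> {1..k} \<Longrightarrow> Y $ row_ix i $ col_ix j = X i j"
    using n by (auto simp: VSASM_cores_def)
  have rs: "row_sum row_ix col_ix i j Y = (\<Sum>j'=1..j. X i j')" if "i \<in> {1..n}" "j \<le> k" for i j
    unfolding row_sum_def using that by (intro sum.cong) (auto intro!: Y)
  have cs: "col_sum row_ix col_ix i j Y = (\<Sum>i'=1..i. X i' j)" if "i \<le> n" "j \<in> {1..k}" for i j
    unfolding col_sum_def using that by (intro sum.cong) (auto intro!: Y)
  have rs01: "row_sum row_ix col_ix i j Y \<in> {0, 1}" if "i \<in> {1..n}" "j \<le> k" for i j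
    using rs[OF that] VSASM_prefix_sums(1)[OF X] that n by simp
  have cs01: "col_sum row_ix col_ix i j Y \<in> {0, 1}" if "i \<le> n" "j \<in> {1..k}" for i j
    using cs[OF that] VSASM_prefix_sums(3)[OF X] that n by simp
  have rsk: "row_sum row_ix col_ix i k Y = of_bool (even i)" if "i \<in> {1..n}" for i
    using rs[OF that] VSASM_row_sum_middle[OF X that] by simp
  have unit: "unit_steps (corner Y)"
    unfolding unit_steps_def
  proof (intro ballI)
    fix i j assume "i \<in> {1..n}" "j \<in> {1..k}"
    then show "corner Y i j - corner Y (i - 1) j \<in> {0..1} \<and> corner Y i j - corner Y i (j - 1) \<in> {0..1}"
      using rs01[of i j] cs01[of i j] by (auto simp: row_sum_conv_corner col_sum_conv_corner)
  qed
  have "corner Y i k = real (i div 2)" if "i \<le> n" for i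
    using that
  proof (induction i)
    case (Suc i)
    then show ?case
      using rsk[of "Suc i"] row_sum_conv_corner[of "Suc i" k Y]
      by (cases "even i") (auto elim!: evenE oddE)
  qed simp
  moreover have outer: "corner Y i j = corner Y (i - 1) j" if i: "i = 1 \<or> i = n" and j: "j \<le> k" for i j
  proof -
    have i1: "i \<in> {1..n}" "odd i" using i n by auto
    \<comment> \<open>The first entry of a column is a partial sum and the last is 1 minus a partial
      sum, so neither is negative. As \<open>i\<close> is odd, these entries total 0 over the first
      \<open>k\<close> columns, and all partial row sums vanish.\<close>
    have "0 \<le> X i a" if "a \<in> {1..k}" for a
    proof -
      have a: "a \<in> {1..n}" using that n by auto
      have "(\<Sum>i'=1..i. X i' a) = (\<Sum>i'=1..i-1. X i' a) + X i a" using i1 by (cases i) auto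
      moreover have "(\<Sum>i'=1..i-1. X i' a) \<in> {0, 1}" using VSASM_prefix_sums(3)[OF X a, of "i - 1"] i1 by auto
      moreover have "(\<Sum>i'=1..1. X i' a) \<in> {0, 1}" using VSASM_prefix_sums(3)[OF X a, of 1] n by auto
      moreover have "(\<Sum>i'=1..n. X i' a) = 1" using VSASM_prefix_sums(4)[OF X a] .
      ultimately show ?thesis using i by auto
    qed
    then have "(\<Sum>a=1..j. X i a) \<le> (\<Sum>a=1..k. X i a)"
      using j by (intro sum_mono2) auto
    then have "row_sum row_ix col_ix i j Y = 0"
      using rs01[OF i1(1) j] rs[OF i1(1)] j rsk[OF i1(1)] i1(2) by auto
    then show ?thesis using row_sum_conv_corner[of i j Y] i1 by simp
  qed
  moreover have bottom: "corner Y n j = real j" if "j \<le> k" for j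
  proof -
    have "col_sum row_ix col_ix n j' Y = 1" if "j' \<in> {1..k}" for j'
      using cs[OF _ that] VSASM_prefix_sums(4)[OF X, of j'] that n by simp
    then show ?thesis unfolding corner_conv_col_sum using that by simp
  qed
  ultimately have "boundary_values (corner Y)"
    unfolding boundary_values_def using outer[of 1] outer[of n] bottom by simp
  with unit show "Y \<in> step_polytope" by (simp add: step_polytope_def boundary_space_def)
qed

lemma integral_step_polytope_core:
  assumes Y: "Y \<in> step_polytope" and int: "\<And>i j. i \<le> n \<Longrightarrow> j \<le> k \<Longrightarrow> corner Y i j \<in> \<int>"
  shows "Y \<in> VSASM_cores n row_ix col_ix"
proof -
  have bv: "boundary_values (corner Y)" and us: "unit_steps (corner Y)"
    using Y by (auto simp: step_polytope_def boundary_space_def)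
  define R where "R i j = row_sum row_ix col_ix i j Y" for i j
  define C where "C i j = col_sum row_ix col_ix i j Y" for i j
  have zero_one: "x \<in> {0, 1}" if "x \<in> \<int>" "x \<in> {0..1}" for x :: real
    using that by (auto elim!: Ints_cases)
  have R01: "R i j \<in> {0, 1}" if "i \<in> {1..n}" "j \<le> k" for i j
  proof (cases "j = 0")
    case False
    then have "corner Y i j - corner Y (i - 1) j \<in> {0..1}" using us that by (simp add: unit_steps_def)
    moreover have "corner Y i j - corner Y (i - 1) j \<in> \<int>" using int that by (auto intro!: Ints_diff)
    ultimately have "corner Y i j - corner Y (i - 1) j \<in> {0, 1}" by (rule zero_one[rotated])
    then show ?thesis unfolding R_def by (subst row_sum_conv_corner) (use that in auto)
  qed (simp add: R_def row_sum_def)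
  have C01: "C i j \<in> {0, 1}" if "i \<le> n" "j \<in> {1..k}" for i j
  proof (cases "i = 0")
    case False
    then have "corner Y i j - corner Y i (j - 1) \<in> {0..1}" using us that by (simp add: unit_steps_def)
    moreover have "corner Y i j - corner Y i (j - 1) \<in> \<int>" using int that by (auto intro!: Ints_diff)
    ultimately have "corner Y i j - corner Y i (j - 1) \<in> {0, 1}" by (rule zero_one[rotated])
    then show ?thesis unfolding C_def by (subst col_sum_conv_corner) (use that in auto)
  qed (simp add: C_def col_sum_def)
  have Rk: "R i k = of_bool (even i)" if "i \<in> {1..n}" for i
  proof -
    have "R i k = real (i div 2) - real ((i - 1) div 2)"
    proof -
      have "i - 1 \<le> n" "i \<le> n" using that by auto
      then have "corner Y i k = real (i div 2)" "corner Y (i - 1) k = real ((i - 1) div 2)"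
        using bv unfolding boundary_values_def by blast+
      then show ?thesis using that row_sum_conv_corner[of i k Y] by (simp add: R_def)
    qed
    moreover have "i div 2 = (i - 1) div 2 + of_bool (even i)" using that by (cases i) auto
    ultimately show ?thesis by simp
  qed
  have Cn: "C n j = 1" if "j \<in> {1..k}" for j
  proof -
    have "corner Y n j = real j" "corner Y n (j - 1) = real (j - 1)"
      using bv that unfolding boundary_values_def by auto
    then show ?thesis using col_sum_conv_corner[of j n Y] that by (simp add: C_def of_nat_diff)
  qed
  \<comment> \<open>The core is reflected around a middle column alternating from 1. A core row sums
    to 1 in even rows and 0 in odd rows, so every full row sums to 1.\<close>
  define X where "X i j = (if j \<le> k then Y $ row_ix i $ col_ix j
    else if j = k + 1 then if odd i then 1 else -1 else Y $ row_ix i $ col_ix (n + 1 - j))" for i j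
  have sum_left: "(\<Sum>j'=1..j. X i j') = R i j" if "j \<le> k" for i j
    unfolding R_def row_sum_def using that by (intro sum.cong) (auto simp: X_def)
  \<comment> \<open>By symmetry the last \<open>n - j\<close> entries sum to
    \<open>R i (n - j)\<close>; the first \<open>j\<close> complement this to 1.\<close>
  have sum_right: "(\<Sum>j'=1..j. X i j') = 1 - R i (n - j)" if i: "i \<in> {1..n}" and j: "k + 1 \<le> j" "j \<le> n" for i j
    using j
  proof (induction j rule: dec_induct)
    case base
    have "(\<Sum>j'=1..k + 1. X i j') = R i k + X i (k + 1)" using sum_left[of k i] by simp
    moreover have "n - (k + 1) = k" using n by simp
    ultimately show ?case using Rk[OF i] by (simp add: X_def)
  next
    case (step j)
    have "n - j = Suc (n - Suc j)" using step by simp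
    then have "R i (n - j) = R i (n - Suc j) + X i (Suc j)"
      using step unfolding R_def row_sum_def by (simp add: X_def)
    then show ?case using step by simp
  qed
  have row: "(\<Sum>j'=1..j. X i j') \<in> {0, 1}" if "i \<in> {1..n}" "j \<le> n" for i j
  proof (cases "j \<le> k")
    case True
    then show ?thesis using sum_left[of j i] R01[of i j] that by simp
  next
    case False
    then show ?thesis using sum_right[of i j] R01[of i "n - j"] that n by auto
  qed
  have row_total: "(\<Sum>j'=1..n. X i j') = 1" if "i \<in> {1..n}" for i
    using sum_right[OF that, of n] n by (simp add: R_def row_sum_def)
  have middle: "(\<Sum>i'=1..i. X i' (k + 1)) = of_bool (odd i)" for i
    by (induction i) (auto simp: X_def)
  have col_left: "(\<Sum>i'=1..i. X i' j) = C i j" if "j \<le> k" for i j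
    unfolding C_def col_sum_def using that by (simp add: X_def)
  have col_right: "(\<Sum>i'=1..i. X i' j) = C i (n + 1 - j)" if "k + 1 < j" for i j
    unfolding C_def col_sum_def using that by (simp add: X_def)
  have col: "(\<Sum>i'=1..i. X i' j) \<in> {0, 1}" and col_total: "(\<Sum>i'=1..n. X i' j) = 1"
    if "i \<le> n" "j \<in> {1..n}" for i j
  proof -
    consider "j \<le> k" | "j = k + 1" | "k + 1 < j" by linarith
    then have "(\<Sum>i'=1..i. X i' j) \<in> {0, 1} \<and> (\<Sum>i'=1..n. X i' j) = 1"
    proof cases
      case 1
      then show ?thesis using col_left C01[of i j] Cn[of j] that by simp
    next
      case 2
      show ?thesis unfolding 2 middle using n by simp
    next
      case 3
      then have "n + 1 - j \<in> {1..k}" using that n by auto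
      then show ?thesis using col_right[OF 3] C01[of i "n + 1 - j"] Cn[of "n + 1 - j"] that by simp
    qed
    then show "(\<Sum>i'=1..i. X i' j) \<in> {0, 1}" "(\<Sum>i'=1..n. X i' j) = 1" by blast+
  qed
  have entries: "X i j \<in> {0, 1, -1}" if "i \<in> {1..n}" "j \<in> {1..n}" for i j
  proof -
    have "(\<Sum>j'=1..j. X i j') = (\<Sum>j'=1..j-1. X i j') + X i j" using that by (cases j) auto
    moreover have "j - 1 \<le> n" "j \<le> n" using that by auto
    ultimately show ?thesis using row[OF that(1), of j] row[OF that(1), of "j - 1"] by auto
  qed
  have "alternating_line n (\<lambda>j. X i j)" if "i \<in> {1..n}" for i
    using alternating_line_iff[of n "\<lambda>j. X i j"] entries row row_total that by blast
  moreover have "alternating_line n (\<lambda>i. X i j)" if "j \<in> {1..n}" for j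
    using alternating_line_iff[of n "\<lambda>i. X i j"] entries col col_total that by blast
  moreover have "X i j = X i (n + 1 - j)" if "j \<in> {1..n}" for i j
    using that n by (auto simp: X_def)
  ultimately have "VSASM n X"
    unfolding VSASM_def ASM_def using entries by blast
  moreover have "\<forall>i\<in>{1..n}. \<forall>j\<in>{1..n div 2}. Y $ row_ix i $ col_ix j = X i j"
    using n by (simp add: X_def)
  ultimately show ?thesis unfolding VSASM_cores_def by blast
qed

text \<open>All extreme points of the relaxation are integral and hence cores, and a compact convex
  set is the hull of its extreme points.\<close>

lemma P_core_eq: "P_core n row_ix col_ix = step_polytope"
proof
  show "P_core n row_ix col_ix \<subseteq> step_polytope"
    unfolding P_core_def by (intro hull_minimal VSASM_cores_subset convex_step_polytope)
  have "{Y. Y extreme_point_of step_polytope} \<subseteq> VSASM_cores n row_ix col_ix"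
    using integral_step_polytope_core extreme_point_corner_integral
    by (auto simp: extreme_point_of_def)
  then show "step_polytope \<subseteq> P_core n row_ix col_ix"
    using Krein_Milman_Minkowski[OF compact_step_polytope convex_step_polytope] hull_mono
    unfolding P_core_def by metis
qed

section \<open>Facets\<close>

lemma lhs_cong:
  assumes "e \<in> facet_equations" and "\<And>i j. i \<le> n \<Longrightarrow> j \<le> k \<Longrightarrow> H i j = H' i j"
  shows "lhs H e = lhs H' e"
  using assms(1) by (cases rule: facet_equations_cases) (use assms(2) in auto)

lemma lhs_of_corner:
  "e \<in> facet_equations \<Longrightarrow> boundary_values H \<Longrightarrow> lhs (corner (of_corner H)) e = lhs H e"
  using lhs_cong corner_of_corner by blast

lemma unit_steps_imp_lhs_le:
  assumes "e \<in> facet_equations" "unit_steps H"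
  shows "lhs H e \<le> rhs e"
  using assms(1)
proof (cases rule: facet_equations_cases)
  case (1 i j c)
  then have "i \<in> {1..n}" "j \<in> {1..k}" by auto
  then show ?thesis using 1 assms(2) unfolding unit_steps_def by auto
next
  case (2 i j c)
  then have "i \<in> {1..n}" "j \<in> {1..k}" by auto
  then show ?thesis using 2 assms(2) unfolding unit_steps_def by auto
qed

lemma linear_lhs_corner: "linear (\<lambda>Y. lhs (corner Y) e)"
proof (cases e)
  case (RowEq i j c)
  then show ?thesis
    using linear_compose_scale_right[OF linear_compose_sub[OF linear_corner linear_corner], of "2 * c - 1" i j "i - 1" j]
    by simp
next
  case (ColEq i j c)
  then show ?thesis
    using linear_compose_scale_right[OF linear_compose_sub[OF linear_corner linear_corner], of "2 * c - 1" i j i "j - 1"]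
    by simp
qed

lemma finite_facet_equations: "finite facet_equations"
proof -
  have "facet_equations \<subseteq> (\<lambda>(i, j, c). RowEq i j c) ` ({..n} \<times> {..k} \<times> {0, 1}) \<union>
      (\<lambda>(i, j, c). ColEq i j c) ` ({..n} \<times> {..k} \<times> {0, 1})"
  proof
    fix e assume "e \<in> facet_equations"
    then show "e \<in> (\<lambda>(i, j, c). RowEq i j c) ` ({..n} \<times> {..k} \<times> {0, 1}) \<union>
      (\<lambda>(i, j, c). ColEq i j c) ` ({..n} \<times> {..k} \<times> {0, 1})"
      by (cases rule: facet_equations_cases) (auto simp: image_iff)
  qed
  then show ?thesis by (rule finite_subset) simp
qed

lemma satisfies_iff_lhs:
  assumes "e \<in> facet_equations"
  shows "satisfies row_ix col_ix e Y \<longleftrightarrow> lhs (corner Y) e = rhs e"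
  using assms
proof (cases rule: facet_equations_cases)
  case (1 i j c)
  then show ?thesis using row_sum_conv_corner[of i j Y] by auto
next
  case (2 i j c)
  then show ?thesis using col_sum_conv_corner[of j i Y] by auto
qed

lemma bij_betw_core_face:
  "bij_betw (core_face n row_ix col_ix) facet_equations {F. F facet_of P_core n row_ix col_ix}"
proof -
  have "bij_betw (\<lambda>e. {Y \<in> P_core n row_ix col_ix. lhs (corner Y) e = rhs e}) facet_equations
    {F. F facet_of P_core n row_ix col_ix}"
  proof (rule bij_betw_facets_of_irredundant_system)
    show "of_corner center \<in> boundary_space"
      by (intro of_corner_in_boundary_space boundary_values_center)
    show "lhs (corner (of_corner center)) e < rhs e" if "e \<in> facet_equations" for e
      using center_strict that lhs_of_corner boundary_values_center by simp
    show "\<exists>Y\<in>boundary_space. rhs e < lhs (corner Y) e \<and>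
        (\<forall>e'\<in>facet_equations - {e}. lhs (corner Y) e' \<le> rhs e')" if e: "e \<in> facet_equations" for e
    proof -
      obtain H where H: "violates_only H e" using exists_violates_only[OF e] by blast
      then have bv: "boundary_values H" by (simp add: violates_only_def)
      show ?thesis
        using H e of_corner_in_boundary_space[OF bv] lhs_of_corner[OF _ bv]
        by (intro bexI[of _ "of_corner H"]) (auto simp: violates_only_def)
    qed
    show "P_core n row_ix col_ix = {Y \<in> boundary_space. \<forall>e\<in>facet_equations. lhs (corner Y) e \<le> rhs e}"
      unfolding P_core_eq step_polytope_def
      using unit_steps_imp_lhs_le unit_steps_if_facet_inequalities
      by (auto simp: boundary_space_def)
  qed (use finite_facet_equations affine_boundary_space linear_lhs_corner in auto)
  moreover have "core_face n row_ix col_ix e = {Y \<in> P_core n row_ix col_ix. lhs (corner Y) e = rhs e}"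
    if "e \<in> facet_equations" for e
    using satisfies_iff_lhs[OF that] by (simp add: core_face_def)
  ultimately show ?thesis using bij_betw_cong by (metis (no_types, lifting))
qed

section \<open>Counting the listed equations\<close>

lemma sum_parity:
  fixes f :: "bool \<Rightarrow> nat"
  shows "(\<Sum>i\<in>{a..<a + 2 * m}. f (even i)) = m * (f True + f False)"
  by (induction m) (cases "even a"; auto simp: algebra_simps)+

lemma card_facet_equations: "int (card facet_equations) = 2 * (int n)\<^sup>2 - 19 * int n + 49"
proof -
  \<comment> \<open>With \<open>k = r + 3\<close> the truncated subtractions in the ranges become
    sums in \<open>r\<close>.\<close>
  obtain r where r: "k = r + 3" using k le_Suc_ex by (metis add.commute)
  let ?A = "SIGMA i:{3..n-2}. {1..k - 1 - of_bool (even i)}"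
  let ?B = "SIGMA i:{4..n-3}. {2..k - 1 - of_bool (odd i)}"
  let ?C = "SIGMA i:{2..n-4}. {2..k - of_bool (even i)}"
  let ?D = "SIGMA i:{4..n-2}. {2..k - of_bool (odd i)}"
  define RA RB KC KD where "RA = (\<lambda>(i, j). RowEq i j 0) ` ?A" and "RB = (\<lambda>(i, j). RowEq i j 1) ` ?B"
    and "KC = (\<lambda>(i, j). ColEq i j 0) ` insert (2, 1) ?C"
    and "KD = (\<lambda>(i, j). ColEq i j 1) ` insert (n - 2, 1) ?D"
  note defs = RA_def RB_def KC_def KD_def
  have "facet_equations = RA \<union> RB \<union> KC \<union> KD"
    unfolding facet_equations_def defs
  proof (intro arg_cong2[where f = "(\<union>)"])
    have image: "(\<lambda>(i, j). f i j) ` S = {f i j | i j. (i, j) \<in> S}" for f :: "nat \<Rightarrow> nat \<Rightarrow> equation" and S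
      by force
    show "{RowEq i j 0 | i j. i \<in> {3..n-2} \<and> j \<in> {1..k - 1 - of_bool (even i)}} = (\<lambda>(i, j). RowEq i j 0) ` ?A"
      "{RowEq i j 1 | i j. i \<in> {4..n-3} \<and> j \<in> {2..k - 1 - of_bool (odd i)}} = (\<lambda>(i, j). RowEq i j 1) ` ?B"
      "{ColEq i j 0 | i j. (i, j) = (2, 1) \<or> i \<in> {2..n-4} \<and> j \<in> {2..k - of_bool (even i)}} =
        (\<lambda>(i, j). ColEq i j 0) ` insert (2, 1) ?C"
      "{ColEq i j 1 | i j. (i, j) = (n-2, 1) \<or> i \<in> {4..n-2} \<and> j \<in> {2..k - of_bool (odd i)}} =
        (\<lambda>(i, j). ColEq i j 1) ` insert (n - 2, 1) ?D"
      unfolding image mem_Sigma_iff insert_iff by (rule refl)+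
  qed
  moreover have "finite RA" "finite RB" "finite KC" "finite KD"
    unfolding defs by (intro finite_imageI finite_insert[THEN iffD2] finite_SigmaI; simp)+
  moreover have "RA \<inter> RB = {}" "(RA \<union> RB) \<inter> KC = {}" "(RA \<union> RB \<union> KC) \<inter> KD = {}"
    unfolding defs by auto
  moreover have "card RA = card ?A" "card RB = card ?B" "card KC = card (insert (2, 1) ?C)"
    "card KD = card (insert (n - 2, 1) ?D)"
    unfolding defs by (rule card_image, force simp: inj_on_def)+
  moreover have "card (insert (2, 1) ?C) = Suc (card ?C)" "card (insert (n - 2, 1) ?D) = Suc (card ?D)"
    by (subst card_insert_disjoint; simp)+
  ultimately have "card facet_equations = card ?A + card ?B + Suc (card ?C) + Suc (card ?D)"
    by (simp only: card_Un_disjoint finite_Un simp_thms)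
  moreover have "card ?A = (r + 2) * (r + 2) + (r + 1) * (r + 1)"
  proof -
    \<comment> \<open>The number of rows is odd: the last row \<open>2 * r + 5\<close> is odd and
      contributes \<open>r + 2\<close>, while the others pair up by parity.\<close>
    have "{3..n-2} = {3..<3 + 2 * (r + 1)} \<union> {2 * r + 5}" using n r by auto
    then have "card ?A = (\<Sum>i\<in>{3..<3 + 2 * (r + 1)}. r + 2 - of_bool (even i)) + (r + 2)"
      using r by (simp add: card_SigmaI)
    also have "(\<Sum>i\<in>{3..<3 + 2 * (r + 1)}. r + 2 - of_bool (even i)) = (r + 1) * (r + 2 + (r + 2 - 1))"
      by (rule trans[OF sum_parity[where f = "\<lambda>b. r + 2 - of_bool b"]]) simp
    finally show ?thesis by (simp add: algebra_simps)
  qed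
  moreover have "card ?B = (r + 1) * (r + 1) + r * r"
  proof -
    have "{4..n-3} = {4..<4 + 2 * r} \<union> {2 * r + 4}" using n r by auto
    then have "card ?B = (\<Sum>i\<in>{4..<4 + 2 * r}. r + 1 - of_bool (odd i)) + (r + 1)"
      using r by (simp add: card_SigmaI)
    also have "(\<Sum>i\<in>{4..<4 + 2 * r}. r + 1 - of_bool (odd i)) = (r) * (r + 1 + (r + 1 - 1))"
      by (rule trans[OF sum_parity[where f = "\<lambda>b. r + 1 - of_bool (\<not> b)"]]) simp
    finally show ?thesis by (simp add: algebra_simps)
  qed
  moreover have "card ?C = (r + 1) * (2 * r + 3)"
  proof -
    have "{2..n-4} = {2..<2 + 2 * (r + 1)}" using n r by auto
    then have "card ?C = (\<Sum>i\<in>{2..<2 + 2 * (r + 1)}. r + 2 - of_bool (even i))"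
      using r by (simp add: card_SigmaI)
    also have "(\<Sum>i\<in>{2..<2 + 2 * (r + 1)}. r + 2 - of_bool (even i)) = (r + 1) * (r + 2 + (r + 2 - 1))"
      by (rule trans[OF sum_parity[where f = "\<lambda>b. r + 2 - of_bool b"]]) simp
    finally show ?thesis by (simp add: algebra_simps)
  qed
  moreover have "card ?D = (r + 1) * (2 * r + 3)"
  proof -
    have "{4..n-2} = {4..<4 + 2 * (r + 1)}" using n r by auto
    then have "card ?D = (\<Sum>i\<in>{4..<4 + 2 * (r + 1)}. r + 2 - of_bool (odd i))"
      using r by (simp add: card_SigmaI)
    also have "(\<Sum>i\<in>{4..<4 + 2 * (r + 1)}. r + 2 - of_bool (odd i)) = (r + 1) * (r + 2 + (r + 2 - 1))"
      by (rule trans[OF sum_parity[where f = "\<lambda>b. r + 2 - of_bool (\<not> b)"]]) simp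
    finally show ?thesis by (simp add: algebra_simps)
  qed
  ultimately show ?thesis
    using n r by (simp add: power2_eq_square algebra_simps)
qed

end

theorem theorem3p8:
  fixes n k :: nat
    and row_ix :: "nat \<Rightarrow> 'n::finite"
    and col_ix :: "nat \<Rightarrow> 'k::finite"
  assumes "odd n" and "n \<ge> 7" and "k = n div 2"
    and "bij_betw row_ix {1..n} (UNIV :: 'n set)"
    and "bij_betw col_ix {1..k} (UNIV :: 'k set)"
  shows "bij_betw (core_face n row_ix col_ix)
           ({RowEq i j 0 | i j. i \<in> {3..n-2} \<and> j \<in> {1..k - 1 - of_bool (even i)}} \<union>
            {RowEq i j 1 | i j. i \<in> {4..n-3} \<and> j \<in> {2..k - 1 - of_bool (odd i)}} \<union>
            {ColEq i j 0 | i j. (i, j) = (2, 1) \<or>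
                                i \<in> {2..n-4} \<and> j \<in> {2..k - of_bool (even i)}} \<union>
            {ColEq i j 1 | i j. (i, j) = (n-2, 1) \<or>
                                i \<in> {4..n-2} \<and> j \<in> {2..k - of_bool (odd i)}})
           {F. F facet_of P_core n row_ix col_ix}
         \<and> int (card {F. F facet_of P_core n row_ix col_ix}) = 2 * (int n)\<^sup>2 - 19 * int n + 49"
proof -
  interpret vsasm_core n k row_ix col_ix
  proof
    show "n = 2 * k + 1" using assms(1,3) by (auto elim!: oddE)
    show "3 \<le> k" using assms(2,3) by auto
  qed (fact assms(4,5))+
  have "card {F. F facet_of P_core n row_ix col_ix} = card facet_equations"
    using bij_betw_same_card[OF bij_betw_core_face] by simp
  then show ?thesis
    using bij_betw_core_face card_facet_equations unfolding facet_equations_def by simp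
qed

end
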